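(* Let $T$ be a strongly$^2$ dependent theory. Then there is no sequence $\langle G_i \mid i<\omega\rangle$ of type definable groups such that for every $i<\omega$, $G_{i+1}$ is a subgroup of $G_i$ and $[G_i:G_{i+1}]=\infty$ (i.e. the index is unbounded).
   Context: $T$ is a complete first order theory and $\mathfrak{C}$ is its monster model (a very big saturated model containing all small models). Tuples are finite unless stated otherwise. Type definable group: given by a partial type $\Sigma(x)$ ($x$ a finite tuple), possibly over a small set of parameters, and a formula $\nu(x,y,z)$ such that $\langle \Sigma(\mathfrak{C}),\nu\rangle$ is a group with $\nu$ defining the (graph of the) group operation. A subgroup relation $H\le G$ between type definable groups means $H(\mathfrak{C})$ is a subgroup of $G(\mathfrak{C})$ (with the same operation). Unbounded index: for type definable groups $H\le G$, the index $[G:H]$ is unbounded, written $[G:H]=\infty$, if for every cardinal $\kappa$ there is a model $M\models T$ (containing the parameters) with $[G^M:H^M]\ge\kappa$. Equivalently, there is in $\mathfrak{C}$ a sequence $\langle a_i\mid i<\omega\rangle$ of elements of $G$, indiscernible over the parameters defining $G$ and $H$, with $a_i\cdot a_j^{-1}\notin H$ for $i<j$. Otherwise the index is bounded, written $[G:H]<\infty$. Indiscernible array: $\langle a_{i,j}\mid i,j<\omega\rangle$ (tuples) is an indiscernible array over $A$ if for each $i_0<\omega$ the row $\langle a_{i_0,j}\mid j<\omega\rangle$ is indiscernible over $A\cup\{a_{i,j}\mid i\ne i_0,\ i,j<\omega\}$. Strongly$^2$ dependent: $T$ is not strongly$^2$ dependent if there are formulas $\langle\varphi_i(x,y_i,z_i)\mid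 i<\omega\rangle$ ($x$ a fixed finite tuple of variables, the lengths of $y_i,z_i$ may depend on $i$), an array $\langle a_{i,j}\mid i,j<\omega\rangle$ which is an indiscernible array over $\emptyset$, and finite tuples $b_k$ from $\{a_{i,j}\mid i<k,\ j<\omega\}$ ($k<\omega$) such that the set $\{\varphi_i(x,a_{i,0},b_i)\wedge\neg\varphi_i(x,a_{i,1},b_i)\mid i<\omega\}$ is consistent. $T$ is strongly$^2$ dependent if no such configuration exists. *)

theory Defs
  imports "HOL-Algebra.Coset"
begin

unbundle cardinal_syntax

section \<open>First-order logic\<close>

datatype 'f trm = Var nat | Fn 'f "'f trm list"

datatype ('f, 'r) fm =
    Eq "'f trm" "'f trm"
  | Rel 'r "'f trm list"
  | Neg "('f, 'r) fm"
  | And "('f, 'r) fm" "('f, 'r) fm"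
  | All nat "('f, 'r) fm"

text \<open>A language is a set of function symbols and a set of relation symbols, each paired with its
  arity. Both sets are arbitrary: they may be empty, and of any cardinality.\<close>

record ('f, 'r) lang =
  fun_syms :: "('f \<times> nat) set"
  rel_syms :: "('r \<times> nat) set"

fun wf_trm :: "('f, 'r) lang \<Rightarrow> 'f trm \<Rightarrow> bool" where
  "wf_trm L (Var x) \<longleftrightarrow> True"
| "wf_trm L (Fn f ts) \<longleftrightarrow> (f, length ts) \<in> fun_syms L \<and> (\<forall>t\<in>set ts. wf_trm L t)"

fun wf_fm :: "('f, 'r) lang \<Rightarrow> ('f, 'r) fm \<Rightarrow> bool" where
  "wf_fm L (Eq s t) \<longleftrightarrow> wf_trm L s \<and> wf_trm L t"
| "wf_fm L (Rel R ts) \<longleftrightarrow> (R, length ts) \<in> rel_syms L \<and> (\<forall>t\<in>set ts. wf_trm L t)"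
| "wf_fm L (Neg \<phi>) \<longleftrightarrow> wf_fm L \<phi>"
| "wf_fm L (And \<phi> \<psi>) \<longleftrightarrow> wf_fm L \<phi> \<and> wf_fm L \<psi>"
| "wf_fm L (All x \<phi>) \<longleftrightarrow> wf_fm L \<phi>"

fun fv_trm :: "'f trm \<Rightarrow> nat set" where
  "fv_trm (Var x) = {x}"
| "fv_trm (Fn f ts) = (\<Union>t\<in>set ts. fv_trm t)"

fun fv :: "('f, 'r) fm \<Rightarrow> nat set" where
  "fv (Eq s t) = fv_trm s \<union> fv_trm t"
| "fv (Rel R ts) = (\<Union>t\<in>set ts. fv_trm t)"
| "fv (Neg \<phi>) = fv \<phi>"
| "fv (And \<phi> \<psi>) = fv \<phi> \<union> fv \<psi>"
| "fv (All x \<phi>) = fv \<phi> - {x}"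

definition formulas :: "('f, 'r) lang \<Rightarrow> ('f, 'r) fm set" where
  "formulas L = {\<phi>. wf_fm L \<phi>}"

definition sentences :: "('f, 'r) lang \<Rightarrow> ('f, 'r) fm set" where
  "sentences L = {\<phi> \<in> formulas L. fv \<phi> = {}}"

record ('f, 'r, 'm) struct =
  univ :: "'m set"
  fn_int :: "'f \<Rightarrow> 'm list \<Rightarrow> 'm"
  rel_int :: "'r \<Rightarrow> 'm list \<Rightarrow> bool"

definition is_structure :: "('f, 'r) lang \<Rightarrow> ('f, 'r, 'm) struct \<Rightarrow> bool" where
  "is_structure L M \<longleftrightarrow> univ M \<noteq> {} \<and>
     (\<forall>(f, n)\<in>fun_syms L. \<forall>as. length as = n \<and> set as \<subseteq> univ M \<longrightarrow> fn_int M f as \<in> univ M)"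

fun val :: "('f, 'r, 'm) struct \<Rightarrow> (nat \<Rightarrow> 'm) \<Rightarrow> 'f trm \<Rightarrow> 'm" where
  "val M e (Var x) = e x"
| "val M e (Fn f ts) = fn_int M f (map (val M e) ts)"

fun sat :: "('f, 'r, 'm) struct \<Rightarrow> (nat \<Rightarrow> 'm) \<Rightarrow> ('f, 'r) fm \<Rightarrow> bool" where
  "sat M e (Eq s t) \<longleftrightarrow> val M e s = val M e t"
| "sat M e (Rel R ts) \<longleftrightarrow> rel_int M R (map (val M e) ts)"
| "sat M e (Neg \<phi>) \<longleftrightarrow> \<not> sat M e \<phi>"
| "sat M e (And \<phi> \<psi>) \<longleftrightarrow> sat M e \<phi> \<and> sat M e \<psi>"
| "sat M e (All x \<phi>) \<longleftrightarrow> (\<forall>a\<in>univ M. sat M (e(x := a)) \<phi>)"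

text \<open>Satisfaction by a finite tuple: the variable \<open>i\<close> is assigned the \<open>i\<close>-th entry. It is only
  used when all free variables of the formula are below the length of the tuple.\<close>

definition holds :: "('f, 'r, 'm) struct \<Rightarrow> ('f, 'r) fm \<Rightarrow> 'm list \<Rightarrow> bool" where
  "holds M \<phi> as \<longleftrightarrow> sat M (\<lambda>i. as ! i) \<phi>"

definition is_model :: "('f, 'r) lang \<Rightarrow> ('f, 'r) fm set \<Rightarrow> ('f, 'r, 'm) struct \<Rightarrow> bool" where
  "is_model L T M \<longleftrightarrow> is_structure L M \<and> (\<forall>\<phi>\<in>T. holds M \<phi> [])"

text \<open>Elementarity for atomic formulas makes \<open>M\<close> a substructure of \<open>N\<close>, so this need not be
  required separately.\<close>

definition elementary_substructure ::
  "('f, 'r) lang \<Rightarrow> ('f, 'r, 'm) struct \<Rightarrow> ('f, 'r, 'm) struct \<Rightarrow> bool" where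
  "elementary_substructure L M N \<longleftrightarrow> is_structure L M \<and> is_structure L N \<and> univ M \<subseteq> univ N \<and>
     (\<forall>\<phi>\<in>formulas L. \<forall>as. set as \<subseteq> univ M \<and> fv \<phi> \<subseteq> {..<length as} \<longrightarrow>
        (holds M \<phi> as \<longleftrightarrow> holds N \<phi> as))"

text \<open>Consistency of \<open>T\<close> and logical consequence are tested on structures whose universe is a set
  of formulas. The type of formulas has cardinality at least that of the set of formulas of \<open>L\<close>,
  so by the downward Loewenheim-Skolem theorem these are the usual notions.\<close>

definition entails :: "('f, 'r) lang \<Rightarrow> ('f, 'r) fm set \<Rightarrow> ('f, 'r) fm \<Rightarrow> bool" where
  "entails L T \<phi> \<longleftrightarrow>
     (\<forall>M :: ('f, 'r, ('f, 'r) fm) struct. is_model L T M \<longrightarrow> holds M \<phi> [])"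

definition complete_theory :: "('f, 'r) lang \<Rightarrow> ('f, 'r) fm set \<Rightarrow> bool" where
  "complete_theory L T \<longleftrightarrow> T \<subseteq> sentences L \<and>
     (\<exists>M :: ('f, 'r, ('f, 'r) fm) struct. is_model L T M) \<and>
     (\<forall>\<phi>\<in>sentences L. entails L T \<phi> \<or> entails L T (Neg \<phi>))"

section \<open>Types with parameters and the monster model\<close>

text \<open>A formula with parameters \<open>\<phi>(x, d)\<close> is a pair \<open>(\<phi>, d)\<close>: in \<open>\<phi>\<close> the variables below
  \<open>n\<close> stand for the tuple \<open>x\<close> of length \<open>n\<close>, the following ones for the finite tuple \<open>d\<close>.\<close>

definition par_formulas ::
  "('f, 'r) lang \<Rightarrow> 'm set \<Rightarrow> nat \<Rightarrow> (('f, 'r) fm \<times> 'm list) set" where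
  "par_formulas L A n =
     {(\<phi>, d). \<phi> \<in> formulas L \<and> set d \<subseteq> A \<and> fv \<phi> \<subseteq> {..<n + length d}}"

definition par_holds ::
  "('f, 'r, 'm) struct \<Rightarrow> ('f, 'r) fm \<times> 'm list \<Rightarrow> 'm list \<Rightarrow> bool" where
  "par_holds M q as \<longleftrightarrow> holds M (fst q) (as @ snd q)"

definition realizations ::
  "('f, 'r, 'm) struct \<Rightarrow> nat \<Rightarrow> (('f, 'r) fm \<times> 'm list) set \<Rightarrow> 'm list set" where
  "realizations M n p =
     {as. length as = n \<and> set as \<subseteq> univ M \<and> (\<forall>q\<in>p. par_holds M q as)}"

definition consistent ::
  "('f, 'r, 'm) struct \<Rightarrow> nat \<Rightarrow> (('f, 'r) fm \<times> 'm list) set \<Rightarrow> bool" where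
  "consistent M n p \<longleftrightarrow> (\<forall>q. finite q \<and> q \<subseteq> p \<longrightarrow> realizations M n q \<noteq> {})"

definition saturated :: "('f, 'r) lang \<Rightarrow> 'k rel \<Rightarrow> ('f, 'r, 'm) struct \<Rightarrow> bool" where
  "saturated L \<kappa> M \<longleftrightarrow>
     (\<forall>A n p. A \<subseteq> univ M \<and> |A| <o \<kappa> \<and> p \<subseteq> par_formulas L A n \<and> consistent M n p \<longrightarrow>
        realizations M n p \<noteq> {})"

text \<open>The size of the monster model is controlled by a cardinal \<open>\<kappa>\<close>: the monster is
  \<open>\<kappa>\<close>-saturated (a saturated model is the case where \<open>\<kappa>\<close> is its cardinality), and ``very
  big'' means that \<open>\<kappa>\<close> exceeds \<open>2\<^sup>\<lambda>\<close> for every small \<open>\<lambda>\<close>. Thus \<open>\<lambda>\<close> counts as small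
  if \<open>2\<^sup>\<lambda> < \<kappa>\<close>; for a strong limit \<open>\<kappa>\<close> this is just \<open>\<lambda> < \<kappa>\<close>. As the set of formulas is
  infinite, \<open>\<kappa>\<close> is uncountable.\<close>

definition small :: "'k rel \<Rightarrow> 'a set \<Rightarrow> bool" where
  "small \<kappa> A \<longleftrightarrow> |Pow A| <o \<kappa>"

definition monster_model ::
  "('f, 'r) lang \<Rightarrow> ('f, 'r) fm set \<Rightarrow> 'k rel \<Rightarrow> ('f, 'r, 'm) struct \<Rightarrow> bool" where
  "monster_model L T \<kappa> C \<longleftrightarrow>
     Card_order \<kappa> \<and> small \<kappa> (formulas L) \<and> is_model L T C \<and> saturated L \<kappa> C"

section \<open>Type definable groups\<close>

record ('f, 'r, 'm) tdgroup =
  tdg_params :: "'m set"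
  tdg_dim :: nat
  tdg_type :: "(('f, 'r) fm \<times> 'm list) set"
  tdg_op :: "('f, 'r) fm \<times> 'm list"

text \<open>\<open>G\<^sup>M\<close>; the identity is written as the unique idempotent.\<close>

definition tdg_group ::
  "('f, 'r, 'm) struct \<Rightarrow> ('f, 'r, 'm) tdgroup \<Rightarrow> 'm list monoid" where
  "tdg_group M G = (let S = realizations M (tdg_dim G) (tdg_type G) in
     \<lparr>carrier = S,
      mult = (\<lambda>a b. THE c. c \<in> S \<and> par_holds M (tdg_op G) (a @ b @ c)),
      one = (THE e. e \<in> S \<and> par_holds M (tdg_op G) (e @ e @ e))\<rparr>)"

definition type_definable_group ::
  "('f, 'r) lang \<Rightarrow> 'k rel \<Rightarrow> ('f, 'r, 'm) struct \<Rightarrow> ('f, 'r, 'm) tdgroup \<Rightarrow> bool" where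
  "type_definable_group L \<kappa> C G \<longleftrightarrow>
     tdg_params G \<subseteq> univ C \<and> small \<kappa> (tdg_params G) \<and>
     tdg_type G \<subseteq> par_formulas L (tdg_params G) (tdg_dim G) \<and>
     tdg_op G \<in> par_formulas L (tdg_params G) (3 * tdg_dim G) \<and>
     (\<forall>a\<in>carrier (tdg_group C G). \<forall>b\<in>carrier (tdg_group C G).
        \<exists>!c. c \<in> carrier (tdg_group C G) \<and> par_holds C (tdg_op G) (a @ b @ c)) \<and>
     group (tdg_group C G)"

definition tdg_subgroup ::
  "('f, 'r, 'm) struct \<Rightarrow> ('f, 'r, 'm) tdgroup \<Rightarrow> ('f, 'r, 'm) tdgroup \<Rightarrow> bool" where
  "tdg_subgroup C H G \<longleftrightarrow>
     subgroup (carrier (tdg_group C H)) (tdg_group C G) \<and>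
     (\<forall>a\<in>carrier (tdg_group C H). \<forall>b\<in>carrier (tdg_group C H).
        a \<otimes>\<^bsub>tdg_group C H\<^esub> b = a \<otimes>\<^bsub>tdg_group C G\<^esub> b)"

text \<open>Models are elementary substructures of the monster \<open>C\<close>, and ``every cardinal'' means every
  cardinal up to \<open>\<kappa>\<close>. For groups over small sets of parameters this agrees with the unrestricted
  notion: an index of at least \<open>\<kappa>\<close> exceeds \<open>2\<^sup>\<lambda>\<close>, where \<open>\<lambda>\<close> is the number of formulas
  over the parameters, so by the Erdos-Rado theorem and compactness the index is unbounded in
  elementary extensions of \<open>C\<close>. Conversely, if it is unbounded there, then by saturation it
  is at least \<open>\<kappa>\<close> in \<open>C\<close>.\<close>

definition unbounded_index ::
  "('f, 'r) lang \<Rightarrow> 'k rel \<Rightarrow> ('f, 'r, 'm) struct \<Rightarrow>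
     ('f, 'r, 'm) tdgroup \<Rightarrow> ('f, 'r, 'm) tdgroup \<Rightarrow> bool" where
  "unbounded_index L \<kappa> C G H \<longleftrightarrow>
     (\<forall>\<mu> :: 'k rel. Card_order \<mu> \<and> \<mu> \<le>o \<kappa> \<longrightarrow>
        (\<exists>M. elementary_substructure L M C \<and> tdg_params G \<union> tdg_params H \<subseteq> univ M \<and>
             \<mu> \<le>o |rcosets\<^bsub>tdg_group M G\<^esub> (carrier (tdg_group M H))| ))"

section \<open>Indiscernibles and strong dependence\<close>

definition indiscernible ::
  "('f, 'r) lang \<Rightarrow> ('f, 'r, 'm) struct \<Rightarrow> 'm set \<Rightarrow> (nat \<Rightarrow> 'm list) \<Rightarrow> bool" where
  "indiscernible L C A a \<longleftrightarrow>
     (\<forall>j. length (a j) = length (a 0) \<and> set (a j) \<subseteq> univ C) \<and>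
     (\<forall>js js' \<phi> d. sorted_wrt (<) js \<and> sorted_wrt (<) js' \<and> length js = length js' \<and>
        (\<phi>, d) \<in> par_formulas L A (length js * length (a 0)) \<longrightarrow>
        (par_holds C (\<phi>, d) (concat (map a js)) \<longleftrightarrow>
         par_holds C (\<phi>, d) (concat (map a js'))))"

definition indiscernible_array ::
  "('f, 'r) lang \<Rightarrow> ('f, 'r, 'm) struct \<Rightarrow> 'm set \<Rightarrow> (nat \<Rightarrow> nat \<Rightarrow> 'm list) \<Rightarrow> bool" where
  "indiscernible_array L C A a \<longleftrightarrow>
     (\<forall>i\<^sub>0. indiscernible L C (A \<union> (\<Union>i\<in>- {i\<^sub>0}. \<Union>j. set (a i j))) (a i\<^sub>0))"

text \<open>Strong\<open>\<^sup>2\<close> dependence of the complete theory of the monster \<open>C\<close>. In \<open>\<phi> i\<close> the variables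
  are ordered as \<open>x, y\<^sub>i, z\<^sub>i\<close>, of lengths \<open>n\<close>, \<open>length (a i 0)\<close> and \<open>length (b i)\<close>. The
  conjunctions are split into their two conjuncts, which have different parameters.\<close>

definition strongly2_dependent ::
  "('f, 'r) lang \<Rightarrow> ('f, 'r, 'm) struct \<Rightarrow> bool" where
  "strongly2_dependent L C \<longleftrightarrow>
     \<not> (\<exists>(n :: nat) (\<phi> :: nat \<Rightarrow> ('f, 'r) fm) (a :: nat \<Rightarrow> nat \<Rightarrow> 'm list) (b :: nat \<Rightarrow> 'm list).
          (\<forall>i. \<phi> i \<in> formulas L \<and> fv (\<phi> i) \<subseteq> {..<n + length (a i 0) + length (b i)}) \<and>
          indiscernible_array L C {} a \<and>
          (\<forall>k. set (b k) \<subseteq> (\<Union>i\<in>{..<k}. \<Union>j. set (a i j))) \<and>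
          consistent C n ((\<Union>i. {(\<phi> i, a i 0 @ b i), (Neg (\<phi> i), a i 1 @ b i)})))"

end

theory Submission
  imports Defs "HOL-Library.Ramsey"
begin

text \<open>
  Suppose that \<open>G\<^sub>0 \<ge> G\<^sub>1 \<ge> \<dots>\<close> is a chain in which every index is unbounded, and choose
  infinitely many right cosets \<open>G\<^sub>i\<^sub>+\<^sub>1 a\<^sub>i\<^sub>,\<^sub>j\<close> in every \<open>G\<^sub>i\<close>. The choices at different levels
  are independent: the product \<open>x = a\<^sub>m\<^sub>,\<^sub>0 \<dots> a\<^sub>0\<^sub>,\<^sub>0\<close> lies in \<open>G\<^sub>i\<^sub>+\<^sub>1 a\<^sub>i\<^sub>,\<^sub>0 b\<^sub>i\<close> for every \<open>i \<le> m\<close>,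
  where \<open>b\<^sub>i = a\<^sub>i\<^sub>-\<^sub>1\<^sub>,\<^sub>0 \<dots> a\<^sub>0\<^sub>,\<^sub>0\<close>, but not in \<open>G\<^sub>i\<^sub>+\<^sub>1 a\<^sub>i\<^sub>,\<^sub>1 b\<^sub>i\<close>. As \<open>b\<^sub>i\<close> is computed from the
  rows before \<open>i\<close>, this is the configuration that strong\<open>\<^sup>2\<close> dependence forbids, once membership
  in the cosets is expressed by formulas and the rows form an indiscernible array.

  \<^emph>\<open>Formulas.\<close> A coset of \<open>G\<^sub>i\<^sub>+\<^sub>1\<close> is only type definable, so a finite part \<open>\<Psi>\<close> of the type of
  \<open>G\<^sub>i\<^sub>+\<^sub>1\<close> must suffice to keep the cosets of the \<open>a\<^sub>i\<^sub>,\<^sub>j\<close> apart (\<open>unbounded_index_separated\<close>).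
  Otherwise, for every \<open>\<Psi>\<close>, a maximal set of elements of \<open>G\<^sub>i\<close> that \<open>\<Psi>\<close> keeps apart is finite. By
  compactness the coset of \<open>g\<close> is determined by the choice, for every \<open>\<Psi>\<close>, of an element of this
  set that \<open>\<Psi>\<close> does not separate from \<open>g\<close>. This leaves at most \<open>2\<^sup>\<lambda>\<close> cosets, where \<open>\<lambda>\<close> is the
  number of formulas over the parameters, and so the index is bounded. Products and quotients
  in \<open>G\<^sub>0\<close> can be expressed inside a formula because a finite part of the type of \<open>G\<^sub>0\<close> already
  makes them unique (\<open>exact_formulas_exist\<close>).

  \<^emph>\<open>Indiscernibility.\<close> By compactness it suffices to treat finitely many conditions
  (\<open>extract_indiscernible_array\<close>). Ramsey's theorem makes the sequence of columns of the array
  indiscernible for the finitely many formulas involved. Now let row \<open>i\<close> read its entries from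
  the \<open>i\<close>-th of consecutive blocks of columns: a change of the columns inside one block does not
  change the order type of all the columns in use, and so the rows are mutually
  indiscernible. The parameters of the formulas are made part of the entries of the array.
  Thus only finitely many parameters matter in each row, and no parameters are left when the
  array is extracted. This matters because a countable union of small sets may fail to be small.

  Formulas are handled as predicates on assignments, for which \<open>definable\<close> has the closure
  properties of first-order logic, and saturation is used for types in infinitely many
  variables (\<open>saturated_assignments\<close>).
\<close>

section \<open>Renaming of variables\<close>

lemma finite_fv_trm: "finite (fv_trm t)"
  by (induction t) auto

lemma finite_fv: "finite (fv \<phi>)"
  by (induction \<phi>) (auto simp: finite_fv_trm)

lemma val_cong: "(\<And>i. i \<in> fv_trm t \<Longrightarrow> e i = e' i) \<Longrightarrow> val M e t = val M e' t"
proof (induction t)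
  case (Fn f ts)
  have "map (val M e) ts = map (val M e') ts"
    using Fn by (intro map_cong) auto
  then show ?case by (simp only: val.simps)
qed auto

lemma sat_cong: "(\<And>i. i \<in> fv \<phi> \<Longrightarrow> e i = e' i) \<Longrightarrow> sat M e \<phi> \<longleftrightarrow> sat M e' \<phi>"
proof (induction \<phi> arbitrary: e e')
  case (Eq s t)
  then show ?case using val_cong[of s e e' M] val_cong[of t e e' M] by auto
next
  case (Rel R ts)
  have "map (val M e) ts = map (val M e') ts"
    using Rel by (intro map_cong refl val_cong) auto
  then show ?case by (simp only: sat.simps)
next
  case (Neg \<phi>)
  have "sat M e \<phi> \<longleftrightarrow> sat M e' \<phi>"
    by (rule Neg.IH) (use Neg.prems in simp)
  then show ?case by simp
next
  case (And \<phi> \<psi>)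
  have "sat M e \<phi> \<longleftrightarrow> sat M e' \<phi>" "sat M e \<psi> \<longleftrightarrow> sat M e' \<psi>"
    by (rule And.IH; use And.prems in simp)+
  then show ?case by simp
next
  case (All x \<phi>)
  have "sat M (e(x := a)) \<phi> \<longleftrightarrow> sat M (e'(x := a)) \<phi>" for a
    by (rule All.IH) (use All.prems in auto)
  then show ?case by simp
qed

fun ren_trm :: "(nat \<Rightarrow> nat) \<Rightarrow> 'f trm \<Rightarrow> 'f trm" where
  "ren_trm f (Var x) = Var (f x)"
| "ren_trm f (Fn g ts) = Fn g (map (ren_trm f) ts)"

text \<open>The bound variable is replaced by one above all images of the free variables, so that
  \<open>f\<close> may identify variables without capture.\<close>

fun ren :: "(nat \<Rightarrow> nat) \<Rightarrow> ('f, 'r) fm \<Rightarrow> ('f, 'r) fm" where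
  "ren f (Eq s t) = Eq (ren_trm f s) (ren_trm f t)"
| "ren f (Rel R ts) = Rel R (map (ren_trm f) ts)"
| "ren f (Neg \<phi>) = Neg (ren f \<phi>)"
| "ren f (And \<phi> \<psi>) = And (ren f \<phi>) (ren f \<psi>)"
| "ren f (All x \<phi>) =
     (let y = Suc (Max (insert 0 (f ` fv \<phi>))) in All y (ren (f(x := y)) \<phi>))"

lemma wf_ren_trm: "wf_trm L t \<Longrightarrow> wf_trm L (ren_trm f t)"
  by (induction t) auto

lemma wf_ren: "wf_fm L \<phi> \<Longrightarrow> wf_fm L (ren f \<phi>)"
  by (induction \<phi> arbitrary: f) (auto simp: wf_ren_trm Let_def)

lemma fv_ren_trm: "fv_trm (ren_trm f t) = f ` fv_trm t"
  by (induction t) auto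

lemma fv_ren: "fv (ren f \<phi>) \<subseteq> f ` fv \<phi>"
proof (induction \<phi> arbitrary: f)
  case (All x \<phi>)
  define y where "y = Suc (Max (insert 0 (f ` fv \<phi>)))"
  have "fv (ren (f(x := y)) \<phi>) \<subseteq> (f(x := y)) ` fv \<phi>"
    by (rule All.IH)
  then show ?case by (auto simp: y_def[symmetric] Let_def split: if_splits)
next
  case (Neg \<phi>)
  then show ?case by simp
next
  case (And \<phi> \<psi>)
  then show ?case by (simp add: image_Un) blast
qed (auto simp: fv_ren_trm)

lemma val_ren: "val M e (ren_trm f t) = val M (\<lambda>i. e (f i)) t"
proof (induction t)
  case (Fn g ts)
  then have "map (val M e) (map (ren_trm f) ts) = map (val M (\<lambda>i. e (f i))) ts" by auto
  then show ?case by (simp only: val.simps ren_trm.simps)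
qed simp

lemma sat_ren: "sat M e (ren f \<phi>) \<longleftrightarrow> sat M (\<lambda>i. e (f i)) \<phi>"
proof (induction \<phi> arbitrary: e f)
  case (Eq s t)
  then show ?case by (simp add: val_ren)
next
  case (Rel R ts)
  have "map (val M e) (map (ren_trm f) ts) = map (val M (\<lambda>i. e (f i))) ts"
    by (simp add: val_ren)
  then show ?case by (simp only: sat.simps ren.simps)
next
  case (All x \<phi>)
  define y where "y = Suc (Max (insert 0 (f ` fv \<phi>)))"
  have y: "f i < y" if "i \<in> fv \<phi>" for i
    using that by (auto simp: y_def finite_fv intro!: le_imp_less_Suc Max_ge)
  have "sat M (e(y := a)) (ren (f(x := y)) \<phi>) \<longleftrightarrow> sat M ((\<lambda>i. e (f i))(x := a)) \<phi>" for a
    unfolding All.IH by (rule sat_cong) (use y in fastforce)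
  then show ?case by (simp add: y_def[symmetric] Let_def)
qed simp_all

lemma ren_formulas: "\<phi> \<in> formulas L \<Longrightarrow> ren f \<phi> \<in> formulas L"
  by (simp add: formulas_def wf_ren)

definition Exi :: "nat \<Rightarrow> ('f, 'r) fm \<Rightarrow> ('f, 'r) fm" where
  "Exi x \<phi> = Neg (All x (Neg \<phi>))"

lemma Exi_simps [simp]:
  "sat M e (Exi x \<phi>) \<longleftrightarrow> (\<exists>a\<in>univ M. sat M (e(x := a)) \<phi>)"
  "fv (Exi x \<phi>) = fv \<phi> - {x}"
  "Exi x \<phi> \<in> formulas L \<longleftrightarrow> \<phi> \<in> formulas L"
  by (auto simp: Exi_def formulas_def)

definition conc :: "'a list \<Rightarrow> (nat \<Rightarrow> 'a) \<Rightarrow> nat \<Rightarrow> 'a" (infixr \<open>\<frown>\<close> 65) where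
  "xs \<frown> e = (\<lambda>i. if i < length xs then xs ! i else e (i - length xs))"

lemma conc_Nil [simp]: "[] \<frown> e = e"
  by (simp add: conc_def)

lemma conc_fst [simp]: "i < length xs \<Longrightarrow> (xs \<frown> e) i = xs ! i"
  and conc_snd [simp]: "length xs \<le> i \<Longrightarrow> (xs \<frown> e) i = e (i - length xs)"
  by (simp_all add: conc_def)

lemma conc_conc [simp]: "xs \<frown> ys \<frown> e = (xs @ ys) \<frown> e"
  by (auto simp: conc_def fun_eq_iff nth_append)

lemma conc_eqI:
  "(\<And>i. i < length xs \<Longrightarrow> f i = xs ! i) \<Longrightarrow> (\<And>i. f (i + length xs) = e i) \<Longrightarrow> f = xs \<frown> e"
  by (rule ext) (metis conc_def le_add_diff_inverse2 not_less)

abbreviation Exis :: "nat \<Rightarrow> ('f, 'r) fm \<Rightarrow> ('f, 'r) fm" where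
  "Exis n \<phi> \<equiv> foldr Exi [0..<n] \<phi>"

lemma fv_foldr_Ex: "fv (foldr Exi xs \<phi>) = fv \<phi> - set xs"
  by (induction xs) auto

lemma foldr_Ex_formulas: "foldr Exi xs \<phi> \<in> formulas L \<longleftrightarrow> \<phi> \<in> formulas L"
  by (induction xs) auto

lemma sat_Exs:
  "sat M e (Exis n \<phi>) \<longleftrightarrow> (\<exists>us. length us = n \<and> set us \<subseteq> univ M \<and> sat M (us \<frown> (\<lambda>i. e (i + n))) \<phi>)"
proof (induction n arbitrary: \<phi>)
  case 0
  then show ?case by simp
next
  case (Suc n)
  have 1: "(us \<frown> (\<lambda>i. e (i + n)))(n := a) = (us @ [a]) \<frown> (\<lambda>i. e (i + Suc n))"
    if "length us = n" for us a
    using that by (intro conc_eqI) (auto simp: nth_append)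
  have 2: "(\<exists>us. length us = Suc n \<and> Q us) \<longleftrightarrow> (\<exists>us a. length us = n \<and> Q (us @ [a]))"
    for Q :: "'c list \<Rightarrow> bool"
    by (metis length_Suc_conv_rev length_append_singleton)
  have "sat M e (Exis (Suc n) \<phi>) \<longleftrightarrow> (\<exists>us. length us = n \<and> set us \<subseteq> univ M \<and>
      (\<exists>a\<in>univ M. sat M ((us \<frown> (\<lambda>i. e (i + n)))(n := a)) \<phi>))"
    using Suc[of "Exi n \<phi>"] by simp
  also have "\<dots> \<longleftrightarrow> (\<exists>us a. length us = n \<and> set (us @ [a]) \<subseteq> univ M \<and>
      sat M ((us @ [a]) \<frown> (\<lambda>i. e (i + Suc n))) \<phi>)"
    by (auto simp: 1 simp del: add_Suc_right cong: conj_cong)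
  also have "\<dots> \<longleftrightarrow> (\<exists>us. length us = Suc n \<and> set us \<subseteq> univ M \<and>
      sat M (us \<frown> (\<lambda>i. e (i + Suc n))) \<phi>)"
    by (rule 2[symmetric])
  finally show ?case .
qed

section \<open>Definable predicates on assignments\<close>

locale saturated_structure =
  fixes L :: "('f, 'r) lang" and \<kappa> :: "'k rel" and C :: "('f, 'r, 'm) struct"
  assumes card: "Card_order \<kappa>"
    and small_formulas: "small \<kappa> (formulas L)"
    and struct: "is_structure L C"
    and saturated: "saturated L \<kappa> C"
begin

text \<open>Definability is a property of predicates on assignments rather than of formulas, so that
  closure under connectives, quantified tuples and substitutions can be used without naming
  variables. The
  parameters occupy the first variables; fixing an initial segment of the assignment thus just
  adds parameters.\<close>

definition definable :: "'m set \<Rightarrow> ((nat \<Rightarrow> 'm) \<Rightarrow> bool) \<Rightarrow> bool" where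
  "definable A P \<longleftrightarrow>
     (\<exists>\<phi>\<in>formulas L. \<exists>d. set d \<subseteq> A \<and> (\<forall>e. P e \<longleftrightarrow> sat C (d \<frown> e) \<phi>))"

lemma definableI:
  "\<phi> \<in> formulas L \<Longrightarrow> set d \<subseteq> A \<Longrightarrow> (\<And>e. P e \<longleftrightarrow> sat C (d \<frown> e) \<phi>) \<Longrightarrow> definable A P"
  unfolding definable_def by blast

lemma definable_mono: "definable A P \<Longrightarrow> A \<subseteq> B \<Longrightarrow> definable B P"
  unfolding definable_def by (meson order_trans)

lemma definable_conc: "definable A P \<Longrightarrow> set vs \<subseteq> A \<Longrightarrow> definable A (\<lambda>e. P (vs \<frown> e))"
  unfolding definable_def by (metis Un_least conc_conc set_append)

lemma definable_Not: "definable A P \<Longrightarrow> definable A (\<lambda>e. \<not> P e)"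
  unfolding definable_def
  apply (elim bexE exE conjE)
  subgoal for \<phi> d by (rule bexI[of _ "Neg \<phi>"]) (auto simp: formulas_def)
  done

lemma definable_And:
  assumes "definable A P" "definable A Q"
  shows "definable A (\<lambda>e. P e \<and> Q e)"
proof -
  obtain \<phi> d \<psi> d' where \<phi>: "\<phi> \<in> formulas L" "set d \<subseteq> A" "\<And>e. P e \<longleftrightarrow> sat C (d \<frown> e) \<phi>"
    and \<psi>: "\<psi> \<in> formulas L" "set d' \<subseteq> A" "\<And>e. Q e \<longleftrightarrow> sat C (d' \<frown> e) \<psi>"
    using assms unfolding definable_def by blast
  \<comment> \<open>The two lists of parameters are put side by side, and the variables of both formulas are
    moved accordingly.\<close>
  define f where "f i = (if i < length d then i else i + length d')" for i
  have f: "(\<lambda>i. ((d @ d') \<frown> e) (f i)) = d \<frown> e" for e :: "nat \<Rightarrow> 'm"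
    by (auto simp: fun_eq_iff f_def conc_def nth_append)
  define g where "g i = i + length d" for i
  have g: "(\<lambda>i. ((d @ d') \<frown> e) (g i)) = d' \<frown> e" for e :: "nat \<Rightarrow> 'm"
    by (auto simp: fun_eq_iff g_def conc_def nth_append)
  show ?thesis
  proof (rule definableI)
    show "And (ren f \<phi>) (ren g \<psi>) \<in> formulas L"
      using \<phi>(1) \<psi>(1) by (simp add: formulas_def wf_ren)
    show "set (d @ d') \<subseteq> A" using \<phi>(2) \<psi>(2) by simp
    show "P e \<and> Q e \<longleftrightarrow> sat C ((d @ d') \<frown> e) (And (ren f \<phi>) (ren g \<psi>))" for e
      using \<phi>(3) \<psi>(3) by (simp add: sat_ren f g)
  qed
qed

lemma definable_True: "definable A (\<lambda>e. True)"
  by (rule definableI[of "Eq (Var 0) (Var 0)" "[]"]) (auto simp: formulas_def)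

lemma definable_eq: "definable A (\<lambda>e. e i = e j)"
  by (rule definableI[of "Eq (Var i) (Var j)" "[]"]) (auto simp: formulas_def)

lemma definable_iff: "definable A P \<Longrightarrow> definable A Q \<Longrightarrow> definable A (\<lambda>e. P e \<longleftrightarrow> Q e)"
  using definable_And[OF definable_Not[OF definable_And[OF _ definable_Not]]
      definable_Not[OF definable_And[OF _ definable_Not]], of A P Q Q P]
  by (rule back_subst[of "definable A"]) auto

lemma definable_Ball:
  assumes "finite I" "\<And>i. i \<in> I \<Longrightarrow> definable A (P i)"
  shows "definable A (\<lambda>e. \<forall>i\<in>I. P i e)"
  using assms
proof (induction I)
  case (insert i I)
  then have "definable A (\<lambda>e. P i e \<and> (\<forall>i\<in>I. P i e))"
    by (intro definable_And) auto
  then show ?case by simp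
qed (simp add: definable_True)

lemma definable_ren:
  assumes "definable A P"
  shows "definable A (\<lambda>e. P (\<lambda>i. e (f i)))"
proof -
  obtain \<phi> d where \<phi>: "\<phi> \<in> formulas L" "set d \<subseteq> A" "\<And>e. P e \<longleftrightarrow> sat C (d \<frown> e) \<phi>"
    using assms unfolding definable_def by blast
  define g where "g i = (if i < length d then i else length d + f (i - length d))" for i
  have g: "(\<lambda>i. (d \<frown> e) (g i)) = d \<frown> (\<lambda>i. e (f i))" for e :: "nat \<Rightarrow> 'm"
    by (auto simp: fun_eq_iff g_def conc_def)
  show ?thesis
    by (rule definableI[of "ren g \<phi>" d]) (use \<phi> in \<open>auto simp: ren_formulas sat_ren g\<close>)
qed

lemma definable_Ex:
  assumes "definable A P"
  shows "definable A (\<lambda>e. \<exists>us. length us = n \<and> set us \<subseteq> univ C \<and> P (us \<frown> e))"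
proof -
  obtain \<phi> d where \<phi>: "\<phi> \<in> formulas L" "set d \<subseteq> A" "\<And>e. P e \<longleftrightarrow> sat C (d \<frown> e) \<phi>"
    using assms unfolding definable_def by blast
  \<comment> \<open>\<open>Exis\<close> binds the first \<open>n\<close> variables, so \<open>f\<close> exchanges the parameters and the tuple
    that is quantified.\<close>
  define f where "f i = (if i < length d then n + i
    else if i < length d + n then i - length d else i)" for i
  have f: "(\<lambda>i. (us \<frown> d \<frown> e) (f i)) = d \<frown> us \<frown> e" if "length us = n" for us and e :: "nat \<Rightarrow> 'm"
    using that unfolding conc_conc by (auto simp: fun_eq_iff f_def conc_def nth_append add.commute)
  have s: "(\<lambda>i. (d \<frown> e) (i + n - n)) = d \<frown> e" for e :: "nat \<Rightarrow> 'm"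
    by simp
  have "sat C (d \<frown> e) (ren (\<lambda>i. i - n) (Exis n (ren f \<phi>))) \<longleftrightarrow>
     (\<exists>us. length us = n \<and> set us \<subseteq> univ C \<and> sat C (\<lambda>i. (us \<frown> d \<frown> e) (f i)) \<phi>)" for e
    unfolding sat_ren sat_Exs s sat_ren ..
  also have "\<dots>e \<longleftrightarrow> (\<exists>us. length us = n \<and> set us \<subseteq> univ C \<and> sat C (d \<frown> us \<frown> e) \<phi>)" for e
    using f by metis
  finally show ?thesis
    by (intro definableI[of "ren (\<lambda>i. i - n) (Exis n (ren f \<phi>))" d])
      (use \<phi> in \<open>auto simp: ren_formulas foldr_Ex_formulas\<close>)
qed

text \<open>The form in which quantified tuples occur: \<open>P\<close> reads the bound tuple from the first
  \<open>n\<close> variables, and its free variables are shifted behind them.\<close>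
lemma definable_Ex_tuple:
  assumes "definable A (\<lambda>e. P (map e [0..<n]) (\<lambda>i. e (i + n)))"
  shows "definable A (\<lambda>e. \<exists>us. length us = n \<and> set us \<subseteq> univ C \<and> P us e)"
proof -
  have 1: "map (us \<frown> e) [0..<n] = us" if "length us = n" for us and e :: "nat \<Rightarrow> 'm"
    using that by (auto intro: nth_equalityI)
  have 2: "(\<lambda>i. (us \<frown> e) (i + n)) = e" if "length us = n" for us and e :: "nat \<Rightarrow> 'm"
    using that by (auto simp: fun_eq_iff)
  show ?thesis using definable_Ex[OF assms, of n]
    by (rule back_subst[of "definable A"]) (intro ext, metis 1 2)
qed

lemma definable_par_holds:
  assumes "q \<in> par_formulas L A n" "length us = n"
  shows "definable A (\<lambda>e. par_holds C q (map e us))"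
proof -
  obtain \<phi> d where q: "q = (\<phi>, d)" by force
  have \<phi>: "\<phi> \<in> formulas L" "set d \<subseteq> A" "fv \<phi> \<subseteq> {..<n + length d}"
    using assms unfolding par_formulas_def q by auto
  define f where "f i = (if i < n then length d + us ! i else i - n)" for i
  have "par_holds C q (map e us) \<longleftrightarrow> sat C (d \<frown> e) (ren f \<phi>)" for e
    unfolding sat_ren par_holds_def holds_def q fst_conv snd_conv
    by (rule sat_cong) (use \<phi>(3) assms(2) in \<open>auto simp: f_def nth_append\<close>)
  then show ?thesis
    by (intro definableI[of "ren f \<phi>" d]) (use \<phi> in \<open>auto simp: ren_formulas\<close>)
qed

lemma definable_holds:
  assumes "\<phi> \<in> formulas L" "fv \<phi> \<subseteq> {..<length us}"
  shows "definable A (\<lambda>e. holds C \<phi> (map e us))"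
  using definable_par_holds[of "(\<phi>, [])" A "length us" us] assms
  by (simp add: par_formulas_def par_holds_def)

lemma univ_nonempty: "univ C \<noteq> {}"
  using struct unfolding is_structure_def by blast

text \<open>Vacuous quantification. The truth of \<open>\<phi>\<close> is constant only for the assignments that agree
  with \<open>e\<close> on \<open>V\<close>, since a predicate becomes independent of the other variables only after its
  parameters have been fixed.\<close>
lemma sat_foldr_Ex_vacuous:
  assumes "\<And>e'. (\<And>i. i \<in> V \<Longrightarrow> e' i = e i) \<Longrightarrow> sat C e' \<phi> = b" and "set xs \<inter> V = {}"
  shows "sat C e (foldr Exi xs \<phi>) = b"
  using assms
proof (induction xs arbitrary: e)
  case (Cons x xs)
  have "sat C (e(x := a)) (foldr Exi xs \<phi>) = b" for a
  proof (rule Cons.IH)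
    fix e' assume "\<And>i. i \<in> V \<Longrightarrow> e' i = (e(x := a)) i"
    then show "sat C e' \<phi> = b" using Cons.prems by (intro Cons.prems(1)) auto
  qed (use Cons.prems in auto)
  then show ?case using univ_nonempty by auto
qed auto

text \<open>The variables from \<open>n\<close> on may occur in the formula that defines \<open>P\<close>; they are quantified
  away vacuously, and the parameters are moved behind the first \<open>n\<close> variables.\<close>

lemma definable_par_formula:
  assumes P: "definable A P" and dep: "\<And>e e'. (\<And>i. i < n \<Longrightarrow> e i = e' i) \<Longrightarrow> P e = P e'"
  obtains q where "q \<in> par_formulas L A n" "\<And>as e. length as = n \<Longrightarrow> par_holds C q as = P (as \<frown> e)"
proof -
  obtain \<phi> d where \<phi>: "\<phi> \<in> formulas L" "set d \<subseteq> A" "\<And>e. P e \<longleftrightarrow> sat C (d \<frown> e) \<phi>"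
    using P unfolding definable_def by blast
  \<comment> \<open>Here the tuple comes first and the parameters follow it.\<close>
  define f where "f i = (if i < length d then i + n
    else if i < length d + n then i - length d else i)" for i
  have f: "(\<lambda>i. ((as @ d) \<frown> e) (f i)) = d \<frown> as \<frown> e" if "length as = n" for as and e :: "nat \<Rightarrow> 'm"
    using that unfolding conc_conc by (auto simp: fun_eq_iff f_def conc_def nth_append add.commute)
  define xs where "xs = filter (\<lambda>i. i \<ge> n + length d) (sorted_list_of_set (fv (ren f \<phi>)))"
  define \<psi> where "\<psi> = foldr Exi xs (ren f \<phi>)"
  have set_xs: "set xs = {i \<in> fv (ren f \<phi>). i \<ge> n + length d}"
    by (simp add: xs_def finite_fv)
  have fv: "fv \<psi> \<subseteq> {..<n + length d}"
    unfolding \<psi>_def fv_foldr_Ex set_xs by (auto simp: not_le)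
  show thesis
  proof
    show "(\<psi>, d) \<in> par_formulas L A n"
      using \<phi> fv by (simp add: par_formulas_def \<psi>_def foldr_Ex_formulas ren_formulas)
    fix as :: "'m list" and e assume as: "length as = n"
    have "par_holds C (\<psi>, d) as \<longleftrightarrow> sat C (\<lambda>i. (as @ d) ! i) \<psi>"
      by (simp add: par_holds_def holds_def)
    also have "\<dots> = P (as \<frown> e)" unfolding \<psi>_def
    proof (rule sat_foldr_Ex_vacuous[where V = "{..<n + length d}"])
      fix e' assume e': "\<And>i. i \<in> {..<n + length d} \<Longrightarrow> e' i = (as @ d) ! i"
      define r where "r = (\<lambda>i. e' (i + (n + length d)))"
      have e'_eq: "e' = (as @ d) \<frown> r"
        using as e' by (intro conc_eqI) (auto simp: r_def)
      have "sat C e' (ren f \<phi>) = P (as \<frown> r)"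
        unfolding e'_eq sat_ren f[OF as] \<phi>(3) ..
      also have "\<dots> = P (as \<frown> e)" using as by (intro dep) auto
      finally show "sat C e' (ren f \<phi>) = P (as \<frown> e)" .
    qed (use set_xs in auto)
    finally show "par_holds C (\<psi>, d) as = P (as \<frown> e)" .
  qed
qed

lemma definable_support:
  assumes "definable A P"
  obtains N where "\<And>e e'. (\<And>i. i < N \<Longrightarrow> e i = e' i) \<Longrightarrow> P e = P e'"
proof -
  obtain \<phi> d where \<phi>: "\<phi> \<in> formulas L" "set d \<subseteq> A" "\<And>e. P e \<longleftrightarrow> sat C (d \<frown> e) \<phi>"
    using assms unfolding definable_def by blast
  obtain N where N: "\<And>i. i \<in> fv \<phi> \<Longrightarrow> i < N" using finite_fv[of \<phi>]
    by (metis finite_nat_set_iff_bounded)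
  show thesis
  proof
    fix e e' :: "nat \<Rightarrow> 'm" assume e: "\<And>i. i < N \<Longrightarrow> e i = e' i"
    show "P e = P e'" unfolding \<phi>(3)
    proof (rule sat_cong)
      fix i assume "i \<in> fv \<phi>"
      then have "i < N" by (rule N)
      then show "(d \<frown> e) i = (d \<frown> e') i" using e by (simp add: conc_def)
    qed
  qed
qed

end

section \<open>Saturation in infinitely many variables\<close>

context saturated_structure
begin

lemma infinite_formulas: "infinite (formulas L)"
proof -
  have "inj (\<lambda>i. Eq (Var i) (Var 0) :: ('f, 'r) fm)" by (auto simp: inj_def)
  then have "infinite (range (\<lambda>i. Eq (Var i) (Var 0) :: ('f, 'r) fm))"
    using finite_imageD infinite_UNIV_nat by blast
  moreover have "range (\<lambda>i. Eq (Var i) (Var 0)) \<subseteq> formulas L" by (auto simp: formulas_def)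
  ultimately show ?thesis using finite_subset by blast
qed

lemma small_less: "small \<kappa> A \<Longrightarrow> |A| <o \<kappa>"
  unfolding small_def using card_of_Pow ordLess_transitive by blast

lemma infinite_card: "infinite (Field \<kappa>)"
proof
  assume "finite (Field \<kappa>)"
  moreover have "|formulas L| \<le>o |Field \<kappa>|"
    using small_less[OF small_formulas] card
    by (meson card_of_Field_ordIso ordIso_symmetric ordLess_imp_ordLeq ordLeq_ordIso_trans)
  ultimately show False
    using card_of_ordLeq_finite infinite_formulas by blast
qed

lemma finite_less: "finite B \<Longrightarrow> |B| <o \<kappa>"
  by (rule finite_ordLess_infinite[OF card_of_Well_order card_order_on_well_order_on[OF card]])
    (simp_all add: Field_card_of infinite_card)

lemma Un_less: "|A| <o \<kappa> \<Longrightarrow> |B| <o \<kappa> \<Longrightarrow> |A \<union> B| <o \<kappa>"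
  by (rule card_of_Un_ordLess_infinite_Field[OF infinite_card card])

abbreviation fin_sat :: "((nat \<Rightarrow> 'm) \<Rightarrow> bool) set \<Rightarrow> 'm list \<Rightarrow> bool" where
  "fin_sat \<Gamma> vs \<equiv>
     (\<forall>F. finite F \<and> F \<subseteq> \<Gamma> \<longrightarrow> (\<exists>e. range e \<subseteq> univ C \<and> (\<forall>P\<in>F. P (vs \<frown> e))))"

text \<open>For each finite part \<open>F\<close> of \<open>\<Gamma>\<close>, that \<open>F\<close> is satisfiable with first value \<open>u\<close> is a formula
  in \<open>u\<close>, because only finitely many other variables occur in \<open>F\<close> and they can be quantified.
  These formulas form a type in one variable, which is realized by saturation.\<close>
lemma fin_sat_extend:
  assumes A: "A \<subseteq> univ C" "|A| <o \<kappa>" and def: "\<And>P. P \<in> \<Gamma> \<Longrightarrow> definable A P"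
    and fs: "fin_sat \<Gamma> []"
  shows "\<exists>u\<in>univ C. fin_sat \<Gamma> [u]"
proof -
  have "\<exists>q\<in>par_formulas L A 1. \<forall>u. par_holds C q [u] \<longleftrightarrow>
      (\<exists>e. range e \<subseteq> univ C \<and> (\<forall>P\<in>F. P ([u] \<frown> e)))"
    if F: "finite F" "F \<subseteq> \<Gamma>" for F
  proof -
    define R where "R e = (\<forall>P\<in>F. P e)" for e
    have R: "definable A R" unfolding R_def using F def by (intro definable_Ball) auto
    then obtain N where N: "\<And>e e'. (\<And>i. i < N \<Longrightarrow> e i = e' i) \<Longrightarrow> R e = R e'"
      using definable_support by blast
    \<comment> \<open>The first variable is free and follows the \<open>N\<close> quantified ones.\<close>
    define f where "f i = (if i = 0 then N else i - 1)" for i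
    define Q where
      "Q e = (\<exists>us. length us = N \<and> set us \<subseteq> univ C \<and> R (\<lambda>i. (us \<frown> e) (f i)))" for e
    have "definable A Q" unfolding Q_def by (rule definable_Ex[OF definable_ren[OF R]])
    moreover have "Q e = Q e'" if e: "\<And>i. i < 1 \<Longrightarrow> e i = e' i" for e e'
    proof -
      have "R (\<lambda>i. (us \<frown> e) (f i)) = R (\<lambda>i. (us \<frown> e') (f i))" if "length us = N" for us
        by (rule N) (use that e in \<open>auto simp: f_def conc_def\<close>)
      then show ?thesis unfolding Q_def by auto
    qed
    ultimately obtain q where q: "q \<in> par_formulas L A 1"
      "\<And>as e. length as = 1 \<Longrightarrow> par_holds C q as = Q (as \<frown> e)"
      using definable_par_formula[of A Q 1] by metis
    obtain u0 where u0: "u0 \<in> univ C" using univ_nonempty by blast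
    have "par_holds C q [u] \<longleftrightarrow> (\<exists>e. range e \<subseteq> univ C \<and> R ([u] \<frown> e))" for u
    proof -
      have "par_holds C q [u] \<longleftrightarrow> Q ([u] \<frown> (\<lambda>_. u0))"
        by (rule q(2)) simp
      also have "\<dots> \<longleftrightarrow> (\<exists>e. range e \<subseteq> univ C \<and> R ([u] \<frown> e))"
      proof
        assume "Q ([u] \<frown> (\<lambda>_. u0))"
        then obtain us where us: "length us = N" "set us \<subseteq> univ C"
          "R (\<lambda>i. (us \<frown> [u] \<frown> (\<lambda>_. u0)) (f i))" unfolding Q_def by blast
        have "R ([u] \<frown> us \<frown> (\<lambda>_. u0))"
          using us(3) by (rule iffD1[OF N, rotated])
            (use us(1) in \<open>auto simp: conc_def f_def nth_append nth_Cons split: nat.splits\<close>)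
        moreover have "range (us \<frown> (\<lambda>_. u0)) \<subseteq> univ C"
          using us(2) u0 by (auto simp: conc_def)
        ultimately show "\<exists>e. range e \<subseteq> univ C \<and> R ([u] \<frown> e)" by blast
      next
        assume "\<exists>e. range e \<subseteq> univ C \<and> R ([u] \<frown> e)"
        then obtain e where e: "range e \<subseteq> univ C" "R ([u] \<frown> e)" by blast
        have "R (\<lambda>i. (map e [0..<N] \<frown> [u] \<frown> (\<lambda>_. u0)) (f i))"
          using e(2) by (rule iffD1[OF N, rotated])
            (auto simp: conc_def f_def nth_append)
        then show "Q ([u] \<frown> (\<lambda>_. u0))" unfolding Q_def using e(1)
          by (intro exI[of _ "map e [0..<N]"]) auto
      qed
      finally show ?thesis .
    qed
    then show ?thesis using q(1) unfolding R_def by blast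
  qed
  then obtain q where q: "\<And>F. finite F \<and> F \<subseteq> \<Gamma> \<Longrightarrow> q F \<in> par_formulas L A 1"
    "\<And>F u. finite F \<and> F \<subseteq> \<Gamma> \<Longrightarrow>
       par_holds C (q F) [u] \<longleftrightarrow> (\<exists>e. range e \<subseteq> univ C \<and> (\<forall>P\<in>F. P ([u] \<frown> e)))"
    by metis
  define p where "p = q ` {F. finite F \<and> F \<subseteq> \<Gamma>}"
  have "consistent C 1 p"
    unfolding consistent_def
  proof (intro allI impI)
    fix r assume r: "finite r \<and> r \<subseteq> p"
    from finite_subset_image[of r q "{F. finite F \<and> F \<subseteq> \<Gamma>}"] r obtain FF
      where FF: "finite FF" "FF \<subseteq> {F. finite F \<and> F \<subseteq> \<Gamma>}" "r = q ` FF"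
      unfolding p_def by (elim conjE exE) blast
    then have "finite (\<Union>FF)" "\<Union>FF \<subseteq> \<Gamma>" by auto
    from fs[rule_format, OF conjI, OF this] obtain e
      where e: "range e \<subseteq> univ C" "\<forall>P\<in>\<Union>FF. P ([] \<frown> e)" by (elim exE conjE)
    have e0: "[e 0] \<frown> (\<lambda>i. e (i + 1)) = e" by (rule sym, rule conc_eqI) auto
    have "par_holds C (q F) [e 0]" if "F \<in> FF" for F
    proof -
      have "\<forall>P\<in>F. P ([e 0] \<frown> (\<lambda>i. e (i + 1)))" unfolding e0 using e(2) that by auto
      moreover have "range (\<lambda>i. e (i + 1)) \<subseteq> univ C" using e(1) by auto
      ultimately show ?thesis using q(2)[of F] FF(2) that by blast
    qed
    then have "[e 0] \<in> realizations C 1 r"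
      using e(1) FF(3) unfolding realizations_def by auto
    then show "realizations C 1 r \<noteq> {}" by blast
  qed
  moreover have "p \<subseteq> par_formulas L A 1" using q(1) unfolding p_def by blast
  ultimately have "realizations C 1 p \<noteq> {}"
    using saturated[unfolded saturated_def, rule_format, of A p 1] A by simp
  then obtain u where u: "u \<in> univ C" "\<forall>q\<in>p. par_holds C q [u]"
    unfolding realizations_def by (auto simp: length_Suc_conv)
  then show ?thesis using q(2) unfolding p_def by (intro bexI[of _ u]) auto
qed

text \<open>The values are found one after the other by \<open>fin_sat_extend\<close>, each joining the parameters of
  the next step. The limit satisfies \<open>\<Gamma>\<close>, as every predicate depends on finitely many
  variables.\<close>
theorem saturated_assignments:
  assumes A: "A \<subseteq> univ C" "|A| <o \<kappa>" and def: "\<And>P. P \<in> \<Gamma> \<Longrightarrow> definable A P"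
    and fs: "\<And>F. finite F \<Longrightarrow> F \<subseteq> \<Gamma> \<Longrightarrow> \<exists>e. range e \<subseteq> univ C \<and> (\<forall>P\<in>F. P e)"
  shows "\<exists>e. range e \<subseteq> univ C \<and> (\<forall>P\<in>\<Gamma>. P e)"
proof -
  define I where "I vs \<longleftrightarrow> set vs \<subseteq> univ C \<and> fin_sat \<Gamma> vs" for vs
  have step: "\<exists>u. I (vs @ [u])" if vs: "I vs" for vs
  proof -
    let ?\<Gamma> = "(\<lambda>P e. P (vs \<frown> e)) ` \<Gamma>"
    have fs': "fin_sat ?\<Gamma> []"
    proof (intro allI impI)
      fix F assume "finite F \<and> F \<subseteq> ?\<Gamma>"
      then obtain F' where F': "finite F'" "F' \<subseteq> \<Gamma>" "F = (\<lambda>P e. P (vs \<frown> e)) ` F'"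
        by (metis finite_subset_image)
      then obtain e where "range e \<subseteq> univ C" "\<forall>P\<in>F'. P (vs \<frown> e)"
        using vs unfolding I_def by blast
      then show "\<exists>e. range e \<subseteq> univ C \<and> (\<forall>P\<in>F. P ([] \<frown> e))" using F'(3) by auto
    qed
    have "\<exists>u\<in>univ C. fin_sat ?\<Gamma> [u]"
    proof (rule fin_sat_extend[OF _ _ _ fs'])
      show "A \<union> set vs \<subseteq> univ C" using A vs by (simp add: I_def)
      show "|A \<union> set vs| <o \<kappa>" by (intro Un_less A finite_less) simp
      show "definable (A \<union> set vs) P" if "P \<in> ?\<Gamma>" for P
        using that def by (auto intro!: definable_conc intro: definable_mono)
    qed
    then obtain u where u: "u \<in> univ C" "fin_sat ?\<Gamma> [u]" by blast
    have "fin_sat \<Gamma> (vs @ [u])"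
    proof (intro allI impI)
      fix F assume F: "finite F \<and> F \<subseteq> \<Gamma>"
      then have "finite ((\<lambda>P e. P (vs \<frown> e)) ` F) \<and> (\<lambda>P e. P (vs \<frown> e)) ` F \<subseteq> ?\<Gamma>" by auto
      from u(2)[rule_format, OF this] obtain e where
        "range e \<subseteq> univ C" "\<forall>P\<in>(\<lambda>P e. P (vs \<frown> e)) ` F. P ([u] \<frown> e)" by (elim exE conjE)
      then show "\<exists>e. range e \<subseteq> univ C \<and> (\<forall>P\<in>F. P ((vs @ [u]) \<frown> e))" by auto
    qed
    then show ?thesis using vs u(1) unfolding I_def by auto
  qed
  then obtain g where g: "\<And>vs. I vs \<Longrightarrow> I (vs @ [g vs])" by metis
  define V where "V = rec_nat [] (\<lambda>_ vs. vs @ [g vs])"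
  define e where "e k = g (V k)" for k
  have V: "V 0 = []" "V (Suc k) = V k @ [e k]" for k by (simp_all add: V_def e_def)
  have I: "I (V k)" for k
  proof (induction k)
    case 0
    then show ?case using fs by (simp add: I_def V)
  next
    case (Suc k)
    then show ?case using g[of "V k"] by (simp add: V e_def)
  qed
  have V_e: "V k = map e [0..<k]" for k
    by (induction k) (simp_all add: V)
  show ?thesis
  proof (intro exI conjI ballI)
    show "range e \<subseteq> univ C"
    proof safe
      fix k show "e k \<in> univ C" using I[of "Suc k"] by (simp add: I_def V)
    qed
    fix P assume P: "P \<in> \<Gamma>"
    then obtain N where N: "\<And>e e'. (\<And>i. i < N \<Longrightarrow> e i = e' i) \<Longrightarrow> P e = P e'"
      using def definable_support by blast
    have *: "finite {P} \<and> {P} \<subseteq> \<Gamma>" using P by simp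
    have "fin_sat \<Gamma> (V N)" using I[of N] by (simp add: I_def)
    from this[rule_format, OF *] obtain e' where "P (V N \<frown> e')" by auto
    moreover have "P (V N \<frown> e') = P e" by (rule N) (simp add: V_e)
    ultimately show "P e" by simp
  qed
qed

text \<open>A version in which only the conditions indexed by \<open>\<Sigma>\<close> are approximated by finite subsets,
  while the prefix \<open>vs\<close> is kept fixed.\<close>
theorem compactness:
  assumes A: "A \<subseteq> univ C" "|A| <o \<kappa>" and vs: "set vs \<subseteq> univ C"
    and B: "\<And>P. P \<in> B \<Longrightarrow> definable A P" and Q: "\<And>q. q \<in> \<Sigma> \<Longrightarrow> definable A (Q q)"
    and fs: "\<And>F. finite F \<Longrightarrow> F \<subseteq> \<Sigma> \<Longrightarrow>
      \<exists>e. range e \<subseteq> univ C \<and> (\<forall>P\<in>B. P (vs \<frown> e)) \<and> (\<forall>q\<in>F. Q q (vs \<frown> e))"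
  shows "\<exists>e. range e \<subseteq> univ C \<and> (\<forall>P\<in>B. P (vs \<frown> e)) \<and> (\<forall>q\<in>\<Sigma>. Q q (vs \<frown> e))"
proof -
  let ?c = "\<lambda>P e. P (vs \<frown> e)"
  have "\<exists>e. range e \<subseteq> univ C \<and> (\<forall>P\<in>?c ` (B \<union> Q ` \<Sigma>). P e)"
  proof (rule saturated_assignments)
    show "A \<union> set vs \<subseteq> univ C" using A vs by simp
    show "|A \<union> set vs| <o \<kappa>" by (intro Un_less A finite_less) simp
    show "definable (A \<union> set vs) P" if "P \<in> ?c ` (B \<union> Q ` \<Sigma>)" for P
      using that B Q by (auto intro!: definable_conc intro: definable_mono)
    fix F assume "finite F" "F \<subseteq> ?c ` (B \<union> Q ` \<Sigma>)"
    then obtain F' where F': "finite F'" "F' \<subseteq> B \<union> Q ` \<Sigma>" "F = ?c ` F'"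
      by (metis finite_subset_image)
    then have "finite (F' - B)" "F' - B \<subseteq> Q ` \<Sigma>" by auto
    then obtain F0 where F0: "finite F0" "F0 \<subseteq> \<Sigma>" "F' - B = Q ` F0"
      by (metis finite_subset_image)
    obtain e where e: "range e \<subseteq> univ C" "\<forall>P\<in>B. P (vs \<frown> e)" "\<forall>q\<in>F0. Q q (vs \<frown> e)"
      using fs[OF F0(1,2)] by blast
    have "P (vs \<frown> e)" if "P \<in> F'" for P
    proof (cases "P \<in> B")
      case False
      then have "P \<in> Q ` F0" using that F0(3) by blast
      then show ?thesis using e(3) by blast
    qed (use e(2) in blast)
    then show "\<exists>e. range e \<subseteq> univ C \<and> (\<forall>P\<in>F. P e)" using e(1) F'(3) by auto
  qed
  then show ?thesis by auto
qed

end

section \<open>Exactness of definable operations\<close>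

definition blk :: "nat \<Rightarrow> nat \<Rightarrow> (nat \<Rightarrow> 'a) \<Rightarrow> 'a list" where
  "blk n k e = map e [k * n..<k * n + n]"

lemma length_blk [simp]: "length (blk n k e) = n"
  by (simp add: blk_def)

lemma set_blk: "range e \<subseteq> A \<Longrightarrow> set (blk n k e) \<subseteq> A"
  by (auto simp: blk_def)

lemma blk_concat:
  "(\<And>t. t \<in> set ts \<Longrightarrow> length t = n) \<Longrightarrow> k < length ts \<Longrightarrow> blk n k (concat ts \<frown> e) = ts ! k"
proof (induction ts arbitrary: k)
  case (Cons t ts)
  have t: "length t = n" using Cons.prems by simp
  show ?case
  proof (cases k)
    case 0
    then show ?thesis using t by (auto simp: blk_def nth_append intro!: nth_equalityI)
  next
    case (Suc k')
    have "blk n k (concat (t # ts) \<frown> e) = blk n k' (concat ts \<frown> e)"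
      using t Suc by (auto simp: blk_def conc_def nth_append intro!: nth_equalityI)
    then show ?thesis using Cons Suc by simp
  qed
qed simp

context saturated_structure
begin

definition definable_rel3 :: "'m set \<Rightarrow> nat \<Rightarrow> ('m list \<Rightarrow> 'm list \<Rightarrow> 'm list \<Rightarrow> bool) \<Rightarrow> bool" where
  "definable_rel3 A n R \<longleftrightarrow> (\<forall>us vs ws. length us = n \<and> length vs = n \<and> length ws = n \<longrightarrow>
     definable A (\<lambda>e. R (map e us) (map e vs) (map e ws)))"

lemma definable_rel3_blk:
  "definable_rel3 A n R \<Longrightarrow> definable A (\<lambda>e. R (blk n i e) (blk n j e) (blk n k e))"
  unfolding definable_rel3_def blk_def by auto

lemma definable_par_holds_blk:
  "q \<in> par_formulas L A n \<Longrightarrow> definable A (\<lambda>e. par_holds C q (blk n k e))"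
  unfolding blk_def by (rule definable_par_holds) auto

lemma definable_eq_tuple:
  assumes "length us = length vs"
  shows "definable A (\<lambda>e. map e us = map e vs)"
proof -
  have "definable A (\<lambda>e. \<forall>i\<in>{..<length us}. e (us ! i) = e (vs ! i))"
    by (intro definable_Ball definable_eq) auto
  then show ?thesis
    by (rule back_subst[of "definable A"]) (use assms in \<open>auto simp: fun_eq_iff list_eq_iff_nth_eq\<close>)
qed

lemma definable_blk_neq: "definable A (\<lambda>e. blk n i e \<noteq> blk n j e)"
  unfolding blk_def by (intro definable_Not definable_eq_tuple) auto

lemma blk_assignment:
  assumes "\<And>t. t \<in> set ts \<Longrightarrow> length t = n \<and> set t \<subseteq> univ C"
  obtains e where "range e \<subseteq> univ C"
    "\<And>ss k. (\<And>s. s \<in> set ss \<Longrightarrow> length s = n) \<Longrightarrow> k < length (ss @ ts) \<Longrightarrow>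
       blk n k (concat ss \<frown> e) = (ss @ ts) ! k"
proof -
  obtain u0 where u0: "u0 \<in> univ C" using univ_nonempty by blast
  show thesis
  proof
    show "range (concat ts \<frown> (\<lambda>_. u0)) \<subseteq> univ C"
      using assms u0 nth_mem[of _ "concat ts"] by (fastforce simp: conc_def)
    fix ss k assume "\<And>s. s \<in> set ss \<Longrightarrow> length s = n" "k < length (ss @ ts)"
    then have "blk n k (concat (ss @ ts) \<frown> (\<lambda>_. u0)) = (ss @ ts) ! k"
      using assms by (intro blk_concat) auto
    then show "blk n k (concat ss \<frown> concat ts \<frown> (\<lambda>_. u0)) = (ss @ ts) ! k" by simp
  qed
qed

text \<open>If no finite \<open>\<Delta>\<close> worked, compactness would give two different solutions inside the type
  definable set. The solution \<open>u\<close> itself ranges over all of \<open>C\<close> and is restricted by \<open>\<Delta>\<close>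
  only, so quantification over \<open>u\<close> can be written as a formula.\<close>

lemma exact_solutions:
  assumes A: "A \<subseteq> univ C" "|A| <o \<kappa>" and \<Sigma>: "\<Sigma> \<subseteq> par_formulas L A n"
    and R: "definable_rel3 A n R"
    and uniq: "\<forall>b\<in>realizations C n \<Sigma>. \<forall>c\<in>realizations C n \<Sigma>. \<forall>u\<in>realizations C n \<Sigma>.
      \<forall>w\<in>realizations C n \<Sigma>. R b c u \<and> R b c w \<longrightarrow> u = w"
  shows "\<exists>\<Delta>. finite \<Delta> \<and> \<Delta> \<subseteq> \<Sigma> \<and> (\<forall>b\<in>realizations C n \<Sigma>. \<forall>c\<in>realizations C n \<Sigma>.
      \<forall>u\<in>realizations C n \<Delta>. \<forall>w\<in>realizations C n \<Sigma>. R b c u \<and> R b c w \<longrightarrow> u = w)"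
proof (rule ccontr)
  assume no: "\<not> ?thesis"
  have bad: "\<exists>b c u w. b \<in> realizations C n \<Sigma> \<and> c \<in> realizations C n \<Sigma> \<and>
      u \<in> realizations C n \<Delta> \<and> w \<in> realizations C n \<Sigma> \<and> R b c u \<and> R b c w \<and> u \<noteq> w"
    if "finite \<Delta>" "\<Delta> \<subseteq> \<Sigma>" for \<Delta>
  proof (rule ccontr)
    assume "\<not> ?thesis"
    then have *: "\<forall>b\<in>realizations C n \<Sigma>. \<forall>c\<in>realizations C n \<Sigma>.
      \<forall>u\<in>realizations C n \<Delta>. \<forall>w\<in>realizations C n \<Sigma>. R b c u \<and> R b c w \<longrightarrow> u = w" by blast
    show False by (rule notE[OF no], rule exI[of _ \<Delta>], intro conjI that *)
  qed
  let ?B = "{\<lambda>e. par_holds C q (blk n k e) | q k. q \<in> \<Sigma> \<and> k \<in> {0, 1, 3}} \<union>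
    {\<lambda>e. R (blk n 0 e) (blk n 1 e) (blk n 2 e), \<lambda>e. R (blk n 0 e) (blk n 1 e) (blk n 3 e),
     \<lambda>e. blk n 2 e \<noteq> blk n 3 e}"
  have "\<exists>e. range e \<subseteq> univ C \<and> (\<forall>P\<in>?B. P ([] \<frown> e)) \<and>
      (\<forall>q\<in>\<Sigma>. par_holds C q (blk n 2 ([] \<frown> e)))"
  proof (rule compactness[OF A])
    show "definable A P" if "P \<in> ?B" for P
      using that \<Sigma> R definable_rel3_blk definable_par_holds_blk definable_blk_neq by blast
    show "definable A (\<lambda>e. par_holds C q (blk n 2 e))" if "q \<in> \<Sigma>" for q
      using that \<Sigma> by (blast intro: definable_par_holds_blk)
    fix F assume "finite F" "F \<subseteq> \<Sigma>"
    then obtain b c u w where *: "b \<in> realizations C n \<Sigma>" "c \<in> realizations C n \<Sigma>"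
      "u \<in> realizations C n F" "w \<in> realizations C n \<Sigma>" "R b c u" "R b c w" "u \<noteq> w"
      using bad by blast
    then have "length t = n \<and> set t \<subseteq> univ C" if "t \<in> set [b, c, u, w]" for t
      using that by (auto simp: realizations_def)
    then obtain e where e: "range e \<subseteq> univ C"
      "\<And>ss k. (\<And>s. s \<in> set ss \<Longrightarrow> length s = n) \<Longrightarrow> k < length (ss @ [b, c, u, w]) \<Longrightarrow>
        blk n k (concat ss \<frown> e) = (ss @ [b, c, u, w]) ! k"
      using blk_assignment[of "[b, c, u, w]" n] by blast
    have "blk n 0 e = b" "blk n 1 e = c" "blk n 2 e = u" "blk n 3 e = w"
      using e(2)[of "[]" 0] e(2)[of "[]" 1] e(2)[of "[]" 2] e(2)[of "[]" 3] by simp_all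
    note blks = this
    have "par_holds C q (blk n k e)" if "q \<in> \<Sigma>" "k \<in> {0, 1, 3}" for q k
      using that * blks by (auto simp: realizations_def)
    moreover have "R (blk n 0 e) (blk n 1 e) (blk n 2 e)" "R (blk n 0 e) (blk n 1 e) (blk n 3 e)"
      "blk n 2 e \<noteq> blk n 3 e" using * blks by simp_all
    ultimately have "P e" if "P \<in> ?B" for P using that by (elim UnE) (blast, blast)
    moreover have "par_holds C q (blk n 2 e)" if "q \<in> F" for q
      using that * blks by (auto simp: realizations_def)
    ultimately show "\<exists>e. range e \<subseteq> univ C \<and> (\<forall>P\<in>?B. P ([] \<frown> e)) \<and>
      (\<forall>q\<in>F. par_holds C q (blk n 2 ([] \<frown> e)))"
      unfolding conc_Nil using e(1) by (intro exI[of _ e] conjI ballI)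
  qed simp
  then obtain e where e1: "range e \<subseteq> univ C" and e2: "\<forall>P\<in>?B. P ([] \<frown> e)"
    and e3: "\<forall>q\<in>\<Sigma>. par_holds C q (blk n 2 ([] \<frown> e))" by (elim exE conjE)
  note e = e1 e2[rule_format, unfolded conc_Nil] e3[rule_format, unfolded conc_Nil]
  have "par_holds C q (blk n k e)" if "q \<in> \<Sigma>" "k \<in> {0, 1, 3}" for q k
    by (rule e(2)) (use that in blast)
  then have "blk n k e \<in> realizations C n \<Sigma>" if "k \<in> {0, 1, 2, 3}" for k
    using e(1,3) that set_blk[OF e(1)] by (auto simp: realizations_def)
  moreover have "R (blk n 0 e) (blk n 1 e) (blk n 2 e)" "R (blk n 0 e) (blk n 1 e) (blk n 3 e)"
    by (rule e(2), blast)+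
  ultimately have "blk n 2 e = blk n 3 e" using uniq by blast
  moreover have "blk n 2 e \<noteq> blk n 3 e" by (rule e(2)) blast
  ultimately show False by blast
qed

end

section \<open>Cardinal bounds\<close>

lemma finite_ordLeq_infinite: "finite A \<Longrightarrow> infinite B \<Longrightarrow> |A| \<le>o |B|"
  by (metis card_of_ordLeq_infinite ordLeq_total card_of_Well_order)

lemma card_of_lists_ordLeq:
  assumes B: "infinite B" and A: "|A| \<le>o |B|"
  shows "|lists A| \<le>o |B|"
proof -
  have "|{xs \<in> lists A. length xs = n}| \<le>o |B|" for n
  proof (induction n)
    case 0
    have "finite {xs \<in> lists A. length xs = 0}" by auto
    then show ?case using B by (rule finite_ordLeq_infinite)
  next
    case (Suc n)
    have "{xs \<in> lists A. length xs = Suc n} =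
        (\<lambda>(x, xs). x # xs) ` (SIGMA x:A. {xs \<in> lists A. length xs = n})"
      by (force simp: length_Suc_conv image_iff)
    then have "|{xs \<in> lists A. length xs = Suc n}| \<le>o |SIGMA x:A. {xs \<in> lists A. length xs = n}|"
      by (simp add: card_of_image)
    also have "|SIGMA x:A. {xs \<in> lists A. length xs = n}| \<le>o |B|"
      using B A Suc by (intro card_of_Sigma_ordLeq_infinite) auto
    finally show ?case .
  qed
  then have "|\<Union>n\<in>UNIV. {xs \<in> lists A. length xs = n}| \<le>o |B|"
    using B by (intro card_of_UNION_ordLeq_infinite) (auto simp: infinite_iff_card_of_nat)
  moreover have "(\<Union>n\<in>UNIV. {xs \<in> lists A. length xs = n}) = lists A" by auto
  ultimately show ?thesis by simp
qed

lemma card_of_finite_subsets_ordLeq: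
  assumes "infinite B" "|A| \<le>o |B|"
  shows "|{F. finite F \<and> F \<subseteq> A}| \<le>o |B|"
proof -
  have "{F. finite F \<and> F \<subseteq> A} = set ` lists A"
  proof safe
    fix F assume "finite F" "F \<subseteq> A"
    then show "F \<in> set ` lists A" using finite_list[of F] by (auto simp: image_iff)
  qed auto
  then show ?thesis
    using ordLeq_transitive[OF card_of_image card_of_lists_ordLeq[OF assms]] by simp
qed

lemma card_of_Pow_ordLeq: "|A| \<le>o |B| \<Longrightarrow> |Pow A| \<le>o |Pow B|"
  unfolding card_of_ordLeq[symmetric]
  by (elim exE conjE, rule_tac x = "image f" in exI) (auto intro: inj_on_image_Pow)

context saturated_structure
begin

text \<open>An infinite sum has the cardinality of its larger summand.\<close>
lemma small_Plus:
  assumes "small \<kappa> X" "small \<kappa> Y" "infinite X"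
  shows "small \<kappa> (X <+> Y)"
proof -
  have "|X <+> Y| \<le>o |X| \<or> |X <+> Y| \<le>o |Y|"
  proof (cases "|Y| \<le>o |X|")
    case True
    then show ?thesis using ordIso_imp_ordLeq[OF card_of_Plus_infinite1[OF assms(3)]] by blast
  next
    case False
    then have "|X| \<le>o |Y|"
      using ordLeq_total[OF card_of_Well_order[of X] card_of_Well_order[of Y]] by simp
    moreover from this have "infinite Y" by (rule card_of_ordLeq_infinite) (rule assms(3))
    ultimately show ?thesis using ordIso_imp_ordLeq[OF card_of_Plus_infinite2] by blast
  qed
  then show ?thesis unfolding small_def
    by (elim disjE) (rule ordLeq_ordLess_trans[OF card_of_Pow_ordLeq], assumption,
        use assms(1,2) in \<open>simp add: small_def\<close>)+
qed

lemma card_of_par_formulas: "|par_formulas L A n| \<le>o |formulas L <+> A|"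
proof -
  let ?B = "formulas L <+> A"
  have B: "infinite ?B" using infinite_formulas by simp
  have "par_formulas L A n \<subseteq> (SIGMA \<phi>:formulas L. lists A)"
    by (auto simp: par_formulas_def)
  then have "|par_formulas L A n| \<le>o |SIGMA \<phi>:formulas L. lists A|" by (rule card_of_mono1)
  also have "|SIGMA \<phi>:formulas L. lists A| \<le>o |?B|"
    using B by (intro card_of_Sigma_ordLeq_infinite ballI card_of_lists_ordLeq
        card_of_Plus1 card_of_Plus2)
  finally show ?thesis .
qed

section \<open>Type definable groups\<close>

lemma carrier_tdg: "carrier (tdg_group M G) = realizations M (tdg_dim G) (tdg_type G)"
  by (simp add: tdg_group_def Let_def)

lemma tdg_op_iff:
  assumes "type_definable_group L \<kappa> C G"
    and "a \<in> carrier (tdg_group C G)" "b \<in> carrier (tdg_group C G)" "c \<in> carrier (tdg_group C G)"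
  shows "par_holds C (tdg_op G) (a @ b @ c) \<longleftrightarrow> c = a \<otimes>\<^bsub>tdg_group C G\<^esub> b"
proof -
  let ?P = "\<lambda>c. c \<in> carrier (tdg_group C G) \<and> par_holds C (tdg_op G) (a @ b @ c)"
  have ex: "\<exists>!c. ?P c" using assms unfolding type_definable_group_def by blast
  have "a \<otimes>\<^bsub>tdg_group C G\<^esub> b = (THE c. ?P c)" by (simp add: tdg_group_def Let_def)
  then have "?P (a \<otimes>\<^bsub>tdg_group C G\<^esub> b)" using theI'[OF ex] by simp
  then show ?thesis using ex assms(4) by blast
qed

lemma params_less: "type_definable_group L \<kappa> C G \<Longrightarrow> |tdg_params G| <o \<kappa>"
  by (simp add: type_definable_group_def small_less)

lemma definable_op:
  assumes "type_definable_group L \<kappa> C G"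
  shows "definable_rel3 (tdg_params G) (tdg_dim G) (\<lambda>a b c. par_holds C (tdg_op G) (a @ b @ c))"
  unfolding definable_rel3_def
proof (intro allI impI)
  fix us vs ws :: "nat list"
  assume "length us = tdg_dim G \<and> length vs = tdg_dim G \<and> length ws = tdg_dim G"
  then have "length (us @ vs @ ws) = 3 * tdg_dim G" by simp
  moreover have "tdg_op G \<in> par_formulas L (tdg_params G) (3 * tdg_dim G)"
    using assms by (simp add: type_definable_group_def)
  ultimately have
    "definable (tdg_params G) (\<lambda>e. par_holds C (tdg_op G) (map e (us @ vs @ ws)))"
    by (rule definable_par_holds[rotated])
  then show "definable (tdg_params G)
      (\<lambda>e. par_holds C (tdg_op G) (map e us @ map e vs @ map e ws))" by simp
qed

text \<open>A finite part of the type of \<open>G\<close> on which the formula of the group operation defines the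
  product and the right quotient of elements of the group, even among values that need not lie
  in the group.\<close>
definition exact_formulas ::
  "('f, 'r, 'm) tdgroup \<Rightarrow> (('f, 'r) fm \<times> 'm list) set \<Rightarrow> bool" where
  "exact_formulas G \<Delta> \<longleftrightarrow> finite \<Delta> \<and> \<Delta> \<subseteq> tdg_type G \<and>
     (\<forall>a\<in>carrier (tdg_group C G). \<forall>b\<in>carrier (tdg_group C G). \<forall>u\<in>realizations C (tdg_dim G) \<Delta>.
        (par_holds C (tdg_op G) (a @ b @ u) \<longleftrightarrow> u = a \<otimes>\<^bsub>tdg_group C G\<^esub> b) \<and>
        (par_holds C (tdg_op G) (u @ a @ b) \<longleftrightarrow>
           u = b \<otimes>\<^bsub>tdg_group C G\<^esub> inv\<^bsub>tdg_group C G\<^esub> a))"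

lemma exact_formulas_exist:
  assumes G: "type_definable_group L \<kappa> C G"
  obtains \<Delta> where "exact_formulas G \<Delta>"
proof -
  let ?G = "tdg_group C G" and ?n = "tdg_dim G" and ?\<Sigma> = "tdg_type G" and ?A = "tdg_params G"
  let ?op = "\<lambda>a b c. par_holds C (tdg_op G) (a @ b @ c)"
  interpret group ?G using G by (simp add: type_definable_group_def)
  have A: "?A \<subseteq> univ C" "|?A| <o \<kappa>" and \<Sigma>: "?\<Sigma> \<subseteq> par_formulas L ?A ?n"
    using G params_less by (auto simp: type_definable_group_def)
  note op = tdg_op_iff[OF G]
  have R1: "definable_rel3 ?A ?n ?op" by (rule definable_op[OF G])
  then have R2: "definable_rel3 ?A ?n (\<lambda>a b c. ?op c a b)" by (simp add: definable_rel3_def)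
  have "\<exists>\<Delta>. finite \<Delta> \<and> \<Delta> \<subseteq> ?\<Sigma> \<and> (\<forall>b\<in>carrier ?G. \<forall>c\<in>carrier ?G.
      \<forall>u\<in>realizations C ?n \<Delta>. \<forall>w\<in>carrier ?G. ?op b c u \<and> ?op b c w \<longrightarrow> u = w)"
    by (rule exact_solutions[OF A \<Sigma> R1, folded carrier_tdg]) (auto simp: op)
  then obtain \<Delta>1 where \<Delta>1: "finite \<Delta>1" "\<Delta>1 \<subseteq> ?\<Sigma>"
    and unique1: "\<forall>b\<in>carrier ?G. \<forall>c\<in>carrier ?G.
      \<forall>u\<in>realizations C ?n \<Delta>1. \<forall>w\<in>carrier ?G. ?op b c u \<and> ?op b c w \<longrightarrow> u = w"
    by (elim exE conjE)
  have "\<exists>\<Delta>. finite \<Delta> \<and> \<Delta> \<subseteq> ?\<Sigma> \<and> (\<forall>b\<in>carrier ?G. \<forall>c\<in>carrier ?G.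
      \<forall>u\<in>realizations C ?n \<Delta>. \<forall>w\<in>carrier ?G. ?op u b c \<and> ?op w b c \<longrightarrow> u = w)"
    by (rule exact_solutions[OF A \<Sigma> R2, folded carrier_tdg]) (auto simp: op)
  then obtain \<Delta>2 where \<Delta>2: "finite \<Delta>2" "\<Delta>2 \<subseteq> ?\<Sigma>"
    and unique2: "\<forall>b\<in>carrier ?G. \<forall>c\<in>carrier ?G.
      \<forall>u\<in>realizations C ?n \<Delta>2. \<forall>w\<in>carrier ?G. ?op u b c \<and> ?op w b c \<longrightarrow> u = w"
    by (elim exE conjE)
  have sub: "realizations C ?n (\<Delta>1 \<union> \<Delta>2) \<subseteq> realizations C ?n \<Delta>1 \<inter> realizations C ?n \<Delta>2"
    by (auto simp: realizations_def)
  have "exact_formulas G (\<Delta>1 \<union> \<Delta>2)"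
    unfolding exact_formulas_def
  proof (intro conjI ballI)
    fix a b u assume a: "a \<in> carrier ?G" and b: "b \<in> carrier ?G"
      and u: "u \<in> realizations C ?n (\<Delta>1 \<union> \<Delta>2)"
    have ab: "a \<otimes>\<^bsub>?G\<^esub> b \<in> carrier ?G" "?op a b (a \<otimes>\<^bsub>?G\<^esub> b)" using a b op by auto
    show "?op a b u \<longleftrightarrow> u = a \<otimes>\<^bsub>?G\<^esub> b"
      using ab unique1 a b u sub by blast
    have "b \<otimes>\<^bsub>?G\<^esub> inv\<^bsub>?G\<^esub> a \<in> carrier ?G" "?op (b \<otimes>\<^bsub>?G\<^esub> inv\<^bsub>?G\<^esub> a) a b"
      using a b op[of "b \<otimes>\<^bsub>?G\<^esub> inv\<^bsub>?G\<^esub> a" a b] by (auto simp: m_assoc)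
    then show "?op u a b \<longleftrightarrow> u = b \<otimes>\<^bsub>?G\<^esub> inv\<^bsub>?G\<^esub> a"
      using unique2 a b u sub by blast
  qed (use \<Delta>1 \<Delta>2 in auto)
  then show thesis by (rule that)
qed

section \<open>Elementary substructures\<close>

lemma par_holds_elementary:
  assumes "elementary_substructure L M C" "q \<in> par_formulas L A n" "A \<subseteq> univ M"
    "length as = n" "set as \<subseteq> univ M"
  shows "par_holds M q as \<longleftrightarrow> par_holds C q as"
  using assms unfolding elementary_substructure_def par_holds_def par_formulas_def
  by (cases q) auto

lemma realizations_elementary:
  assumes M: "elementary_substructure L M C" and "\<Sigma> \<subseteq> par_formulas L A n" "A \<subseteq> univ M"
  shows "realizations M n \<Sigma> = {as \<in> realizations C n \<Sigma>. set as \<subseteq> univ M}"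
proof -
  have "univ M \<subseteq> univ C" using M by (simp add: elementary_substructure_def)
  then show ?thesis
    using par_holds_elementary[OF M _ assms(3)] assms(2) unfolding realizations_def by blast
qed

lemma holds_Exs:
  assumes "fv \<phi> \<subseteq> {..<n + length d}" "length xs = n"
  shows "holds N (Exis n \<phi>) (xs @ d) \<longleftrightarrow>
    (\<exists>us. length us = n \<and> set us \<subseteq> univ N \<and> holds N \<phi> (us @ d))"
proof -
  have "sat N (us \<frown> (\<lambda>i. (xs @ d) ! (i + n))) \<phi> \<longleftrightarrow> holds N \<phi> (us @ d)" if "length us = n" for us
    unfolding holds_def by (rule sat_cong) (use assms that in \<open>auto simp: conc_def nth_append\<close>)
  then show ?thesis unfolding holds_def[of N "Exis n \<phi>"] sat_Exs by blast
qed

text \<open>The Tarski-Vaught property, for tuples and for predicates with parameters in \<open>M\<close>.\<close>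
lemma elementary_witness:
  assumes M: "elementary_substructure L M C" and P: "definable (univ M) P"
    and dep: "\<And>e e'. (\<And>i. i < n \<Longrightarrow> e i = e' i) \<Longrightarrow> P e = P e'"
    and us: "length us = n" "set us \<subseteq> univ C" "P (us \<frown> e)"
  shows "\<exists>us. length us = n \<and> set us \<subseteq> univ M \<and> P (us \<frown> e)"
proof -
  obtain q where q: "q \<in> par_formulas L (univ M) n"
    "\<And>as e. length as = n \<Longrightarrow> par_holds C q as = P (as \<frown> e)"
    using definable_par_formula[OF P dep] by metis
  obtain \<phi> d where \<phi>d: "q = (\<phi>, d)" by force
  have \<phi>: "\<phi> \<in> formulas L" "set d \<subseteq> univ M" "fv \<phi> \<subseteq> {..<n + length d}"
    using q(1) by (auto simp: par_formulas_def \<phi>d)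
  obtain m where m: "m \<in> univ M"
    using M unfolding elementary_substructure_def is_structure_def by blast
  let ?xs = "replicate n m"
  have "holds C \<phi> (us @ d)" using us q(2)[of us] by (simp add: par_holds_def \<phi>d)
  then have "holds C (Exis n \<phi>) (?xs @ d)" using us \<phi>(3) by (subst holds_Exs) auto
  moreover have "fv (Exis n \<phi>) \<subseteq> {..<length (?xs @ d)}" using \<phi>(3) by (auto simp: fv_foldr_Ex)
  moreover have "set (?xs @ d) \<subseteq> univ M" using m \<phi>(2) by auto
  moreover have "Exis n \<phi> \<in> formulas L" using \<phi>(1) by (simp add: foldr_Ex_formulas)
  ultimately have "holds M (Exis n \<phi>) (?xs @ d)"
    using M unfolding elementary_substructure_def by blast
  then obtain vs where vs: "length vs = n" "set vs \<subseteq> univ M" "holds M \<phi> (vs @ d)"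
    using \<phi>(3) by (subst (asm) holds_Exs) auto
  then have "par_holds C q vs"
    using par_holds_elementary[OF M q(1) order_refl vs(1,2)] by (simp add: par_holds_def \<phi>d)
  then show ?thesis using vs q(2) by blast
qed

text \<open>Products and quotients are the unique solutions of exact formulas, so they lie in every
  elementary substructure that contains the arguments and the parameters.\<close>

lemma group_closed_elementary:
  assumes G: "type_definable_group L \<kappa> C G" and M: "elementary_substructure L M C"
    and "tdg_params G \<subseteq> univ M"
    and a: "a \<in> carrier (tdg_group C G)" "set a \<subseteq> univ M"
    and b: "b \<in> carrier (tdg_group C G)" "set b \<subseteq> univ M"
  shows "set (a \<otimes>\<^bsub>tdg_group C G\<^esub> b) \<subseteq> univ M"
    and "set (b \<otimes>\<^bsub>tdg_group C G\<^esub> inv\<^bsub>tdg_group C G\<^esub> a) \<subseteq> univ M"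
proof -
  let ?G = "tdg_group C G" and ?n = "tdg_dim G"
  interpret group ?G using G by (simp add: type_definable_group_def)
  obtain \<Delta> where \<Delta>: "exact_formulas G \<Delta>" using exact_formulas_exist[OF G] .
  have in_real: "c \<in> realizations C ?n \<Delta>" if "c \<in> carrier ?G" for c
    using that \<Delta> unfolding exact_formulas_def carrier_tdg realizations_def by blast
  have \<Delta>': "finite \<Delta>" "\<Delta> \<subseteq> par_formulas L (tdg_params G) ?n"
    using \<Delta> G by (auto simp: exact_formulas_def type_definable_group_def)
  have len: "length a = ?n" "length b = ?n" using a b by (auto simp: carrier_tdg realizations_def)
  have sub: "univ M \<subseteq> univ C" using M by (simp add: elementary_substructure_def)
  have witness: "set c \<subseteq> univ M"
    if R: "definable_rel3 (tdg_params G) ?n R"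
      and c: "c \<in> carrier ?G" "R a b c"
      and unique: "\<And>u. u \<in> realizations C ?n \<Delta> \<Longrightarrow> R a b u \<Longrightarrow> u = c" for R c
  proof -
    define P where "P e \<longleftrightarrow> (\<forall>q\<in>\<Delta>. par_holds C q (map e [0..<?n])) \<and> R a b (map e [0..<?n])" for e
    have "definable (tdg_params G) (\<lambda>e. R (blk ?n 0 e) (blk ?n 1 e) (blk ?n 2 e))"
      using R by (rule definable_rel3_blk)
    then have "definable (univ M) (\<lambda>e. R (blk ?n 0 ((a @ b) \<frown> e)) (blk ?n 1 ((a @ b) \<frown> e))
        (blk ?n 2 ((a @ b) \<frown> e)))"
      using a b assms(3) by (intro definable_conc[where P = "\<lambda>e. R (blk ?n 0 e) (blk ?n 1 e) (blk ?n 2 e)"])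
        (auto intro: definable_mono)
    moreover have "blk ?n 0 ((a @ b) \<frown> e) = a" "blk ?n 1 ((a @ b) \<frown> e) = b"
      "blk ?n 2 ((a @ b) \<frown> e) = map e [0..<?n]" for e
      using len by (auto simp: blk_def conc_def nth_append intro!: nth_equalityI)
    ultimately have "definable (univ M) (\<lambda>e. R a b (map e [0..<?n]))" by simp
    moreover have "definable (univ M) (\<lambda>e. par_holds C q (map e [0..<?n]))" if "q \<in> \<Delta>" for q
      using that \<Delta>' assms(3)
      by (intro definable_mono[OF definable_par_holds[of q "tdg_params G" ?n]]) auto
    ultimately have def: "definable (univ M) P"
      unfolding P_def by (intro definable_And definable_Ball \<Delta>'(1))
    have "P e = P e'" if "\<And>i. i < ?n \<Longrightarrow> e i = e' i" for e e'
    proof -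
      have "map e [0..<?n] = map e' [0..<?n]" using that by auto
      then show ?thesis unfolding P_def by (simp only:)
    qed
    moreover obtain u0 where "u0 \<in> univ C" using univ_nonempty by blast
    have map_conc: "map (us \<frown> (\<lambda>_. u0)) [0..<?n] = us" if "length us = ?n" for us
      using that by (auto intro: nth_equalityI)
    have c': "length c = ?n" "set c \<subseteq> univ C" using c by (auto simp: carrier_tdg realizations_def)
    moreover have "P (c \<frown> (\<lambda>_. u0))"
      using c in_real[OF c(1)] unfolding P_def map_conc[OF c'(1)] by (auto simp: realizations_def)
    ultimately obtain us where us: "length us = ?n" "set us \<subseteq> univ M" "P (us \<frown> (\<lambda>_. u0))"
      using elementary_witness[OF M def, of ?n c "\<lambda>_. u0"] by blast
    have "us \<in> realizations C ?n \<Delta>" "R a b us"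
      using us(3) us(1,2) sub unfolding P_def map_conc[OF us(1)] by (auto simp: realizations_def)
    then show ?thesis using unique us(2) by blast
  qed
  have R1: "definable_rel3 (tdg_params G) ?n (\<lambda>a b c. par_holds C (tdg_op G) (a @ b @ c))"
    by (rule definable_op[OF G])
  then have R2: "definable_rel3 (tdg_params G) ?n (\<lambda>a b c. par_holds C (tdg_op G) (c @ a @ b))"
    by (simp add: definable_rel3_def)
  have closed: "a \<otimes>\<^bsub>?G\<^esub> b \<in> carrier ?G" "b \<otimes>\<^bsub>?G\<^esub> inv\<^bsub>?G\<^esub> a \<in> carrier ?G" using a b by auto
  show "set (a \<otimes>\<^bsub>?G\<^esub> b) \<subseteq> univ M"
    using \<Delta> a b closed in_real by (intro witness[OF R1]) (auto simp: exact_formulas_def)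
  show "set (b \<otimes>\<^bsub>?G\<^esub> inv\<^bsub>?G\<^esub> a) \<subseteq> univ M"
    using \<Delta> a b closed in_real by (intro witness[OF R2]) (auto simp: exact_formulas_def m_assoc)
qed

end

section \<open>Separated cosets\<close>

context saturated_structure
begin

text \<open>Let \<open>U\<close> be the set of elements of \<open>G\<close> that satisfy \<open>\<Psi>\<close>. The relation says that \<open>U g\<close> and
  \<open>U h\<close> meet. When \<open>\<Psi>\<close> runs through the finite parts of the type of a subgroup \<open>H\<close>, the sets
  \<open>U\<close> approximate \<open>H\<close>, and \<open>U g\<close> approximates the coset \<open>H g\<close>.\<close>
abbreviation cosets_meet ::
  "('f, 'r, 'm) tdgroup \<Rightarrow> (('f, 'r) fm \<times> 'm list) set \<Rightarrow> 'm list \<Rightarrow> 'm list \<Rightarrow> bool" where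
  "cosets_meet G \<Psi> g h \<equiv>
     (\<exists>u v. u \<in> carrier (tdg_group C G) \<and> v \<in> carrier (tdg_group C G) \<and>
        u \<in> realizations C (tdg_dim G) \<Psi> \<and> v \<in> realizations C (tdg_dim G) \<Psi> \<and>
        u \<otimes>\<^bsub>tdg_group C G\<^esub> g = v \<otimes>\<^bsub>tdg_group C G\<^esub> h)"

lemma subgroup_dim:
  assumes "tdg_subgroup C H G"
  shows "tdg_dim H = tdg_dim G"
proof -
  have "subgroup (carrier (tdg_group C H)) (tdg_group C G)"
    using assms by (simp add: tdg_subgroup_def)
  then obtain x where "x \<in> carrier (tdg_group C H)" "x \<in> carrier (tdg_group C G)"
    using subgroup.one_closed subgroup.subset by blast
  then show ?thesis by (simp add: carrier_tdg realizations_def)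
qed

text \<open>By compactness a single \<open>x\<close> serves for all \<open>\<Psi>\<close>, with all multipliers in \<open>H\<close>; then \<open>g\<close> and
  \<open>h\<close> both lie in the coset of \<open>x\<close>.\<close>
lemma same_coset:
  assumes G: "type_definable_group L \<kappa> C G" and H: "type_definable_group L \<kappa> C H"
    and sub: "tdg_subgroup C H G"
    and g: "g \<in> carrier (tdg_group C G)" and h: "h \<in> carrier (tdg_group C G)"
    and meet: "\<And>\<Psi>. finite \<Psi> \<Longrightarrow> \<Psi> \<subseteq> tdg_type H \<Longrightarrow>
      \<exists>x\<in>carrier (tdg_group C G). cosets_meet G \<Psi> g x \<and> cosets_meet G \<Psi> h x"
  shows "g \<otimes>\<^bsub>tdg_group C G\<^esub> inv\<^bsub>tdg_group C G\<^esub> h \<in> carrier (tdg_group C H)"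
proof -
  let ?G = "tdg_group C G" and ?n = "tdg_dim G" and ?A = "tdg_params G \<union> tdg_params H"
  let ?op = "\<lambda>a b c. par_holds C (tdg_op G) (a @ b @ c)"
  interpret group ?G using G by (simp add: type_definable_group_def)
  interpret subgroup "carrier (tdg_group C H)" ?G using sub by (simp add: tdg_subgroup_def)
  have A: "?A \<subseteq> univ C" "|?A| <o \<kappa>"
    using G H Un_less[OF params_less[OF G] params_less[OF H]]
    by (simp_all add: type_definable_group_def)
  have \<Sigma>: "tdg_type G \<subseteq> par_formulas L ?A ?n" "tdg_type H \<subseteq> par_formulas L ?A ?n"
    using G H subgroup_dim[OF sub] by (auto simp: type_definable_group_def par_formulas_def)
  have R: "definable_rel3 ?A ?n ?op"
    using definable_op[OF G] definable_mono unfolding definable_rel3_def by blast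
  have len: "length g = ?n" "length h = ?n" "set g \<subseteq> univ C" "set h \<subseteq> univ C"
    using g h by (auto simp: carrier_tdg realizations_def)
  let ?vs = "concat [g, h]"
  \<comment> \<open>The blocks are \<open>g, h, x, u, v, u', v'\<close>, the common value of \<open>u g\<close> and \<open>v x\<close>, and that of
    \<open>u' h\<close> and \<open>v' x\<close>.\<close>
  let ?B = "{\<lambda>e. par_holds C q (blk ?n k e) | q k. q \<in> tdg_type G \<and> k \<in> {2..8}} \<union>
    {\<lambda>e. ?op (blk ?n i e) (blk ?n j e) (blk ?n k e) | i j k.
       (i, j, k) \<in> {(3, 0, 7), (4, 2, 7), (5, 1, 8), (6, 2, 8)}}"
  let ?Q = "\<lambda>q e. \<forall>k\<in>{3..6}. par_holds C q (blk ?n k e)"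
  have "\<exists>e. range e \<subseteq> univ C \<and> (\<forall>P\<in>?B. P (?vs \<frown> e)) \<and> (\<forall>q\<in>tdg_type H. ?Q q (?vs \<frown> e))"
  proof (rule compactness[OF A])
    show "set ?vs \<subseteq> univ C" using len by simp
    show "definable ?A P" if "P \<in> ?B" for P
      using that
    proof (elim UnE CollectE exE conjE)
      fix q k assume "P = (\<lambda>e. par_holds C q (blk ?n k e))" "q \<in> tdg_type G"
      then show "definable ?A P" using \<Sigma> definable_par_holds_blk by blast
    next
      fix i j k assume "P = (\<lambda>e. ?op (blk ?n i e) (blk ?n j e) (blk ?n k e))"
      then show "definable ?A P" using definable_rel3_blk[OF R] by simp
    qed
    show "definable ?A (?Q q)" if "q \<in> tdg_type H" for q
      using that \<Sigma> by (intro definable_Ball definable_par_holds_blk) auto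
    fix F assume F: "finite F" "F \<subseteq> tdg_type H"
    obtain x u v u' v' where x: "x \<in> carrier ?G" and uv: "u \<in> carrier ?G" "v \<in> carrier ?G"
        "u' \<in> carrier ?G" "v' \<in> carrier ?G"
      and F: "u \<in> realizations C ?n F" "v \<in> realizations C ?n F"
        "u' \<in> realizations C ?n F" "v' \<in> realizations C ?n F"
      and eq: "u \<otimes>\<^bsub>?G\<^esub> g = v \<otimes>\<^bsub>?G\<^esub> x" "u' \<otimes>\<^bsub>?G\<^esub> h = v' \<otimes>\<^bsub>?G\<^esub> x"
      using meet[OF F] by blast
    define ts where "ts = [x, u, v, u', v', u \<otimes>\<^bsub>?G\<^esub> g, u' \<otimes>\<^bsub>?G\<^esub> h]"
    have ts_carrier: "set ts \<subseteq> carrier ?G" using x uv g h by (simp add: ts_def)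
    then have "length t = ?n \<and> set t \<subseteq> univ C" if "t \<in> set ts" for t
      using that by (auto simp: carrier_tdg realizations_def)
    then obtain e where e: "range e \<subseteq> univ C"
      "\<And>ss k. (\<And>s. s \<in> set ss \<Longrightarrow> length s = ?n) \<Longrightarrow> k < length (ss @ ts) \<Longrightarrow>
        blk ?n k (concat ss \<frown> e) = (ss @ ts) ! k"
      using blk_assignment[of ts ?n] by blast
    have blks: "blk ?n k (?vs \<frown> e) = ([g, h] @ ts) ! k" if "k < 9" for k
      by (rule e(2)) (use len that in \<open>auto simp: ts_def\<close>)
    have "par_holds C q (blk ?n k (?vs \<frown> e))" if q: "q \<in> tdg_type G" and k: "k \<in> {2..8}" for q k
    proof -
      have "([g, h] @ ts) ! k = ts ! (k - 2)"
        using k by (simp add: nth_append numeral_2_eq_2 del: append_Cons append_Nil)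
      moreover have "ts ! (k - 2) \<in> carrier ?G"
        using ts_carrier k by (intro subsetD[OF ts_carrier] nth_mem) (auto simp: ts_def)
      ultimately have "blk ?n k (?vs \<frown> e) \<in> carrier ?G" using blks k by auto
      then show ?thesis using q by (auto simp: carrier_tdg realizations_def)
    qed
    moreover have "?op (blk ?n i (?vs \<frown> e)) (blk ?n j (?vs \<frown> e)) (blk ?n k (?vs \<frown> e))"
      if "(i, j, k) \<in> {(3, 0, 7), (4, 2, 7), (5, 1, 8), (6, 2, 8)}" for i j k
    proof -
      have "?op u g (u \<otimes>\<^bsub>?G\<^esub> g)" "?op v x (u \<otimes>\<^bsub>?G\<^esub> g)" "?op u' h (u' \<otimes>\<^bsub>?G\<^esub> h)"
        "?op v' x (u' \<otimes>\<^bsub>?G\<^esub> h)"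
        using x uv g h eq by (auto simp: tdg_op_iff[OF G])
      moreover have "i < 9" "j < 9" "k < 9" using that by auto
      ultimately show ?thesis using that by (auto simp only: blks) (auto simp: ts_def)
    qed
    ultimately have "\<forall>P\<in>?B. P (?vs \<frown> e)" by (intro ballI) (elim UnE CollectE exE conjE, auto)
    moreover have "\<forall>q\<in>F. ?Q q (?vs \<frown> e)"
    proof
      fix q assume q: "q \<in> F"
      show "?Q q (?vs \<frown> e)" 
      proof
        fix k :: nat assume "k \<in> {3..6}"
        then have k: "k = 3 \<or> k = 4 \<or> k = 5 \<or> k = 6" by auto
        then have "blk ?n k (?vs \<frown> e) \<in> realizations C ?n F"
          using F blks[of k] by (auto simp: ts_def)
        then show "par_holds C q (blk ?n k (?vs \<frown> e))" using q by (auto simp: realizations_def)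
      qed
    qed
    ultimately show "\<exists>e. range e \<subseteq> univ C \<and> (\<forall>P\<in>?B. P (?vs \<frown> e)) \<and> (\<forall>q\<in>F. ?Q q (?vs \<frown> e))"
      by (intro exI[of _ e] conjI e(1))
  qed
  then obtain e where e: "range e \<subseteq> univ C" and eB: "\<forall>P\<in>?B. P (?vs \<frown> e)"
    and eQ: "\<forall>q\<in>tdg_type H. ?Q q (?vs \<frown> e)" by (elim exE conjE)
  define b where "b k = blk ?n k (?vs \<frown> e)" for k
  have b01: "b 0 = g" "b 1 = h"
    using len by (auto simp: b_def blk_def conc_def nth_append intro!: nth_equalityI)
  have b_univ: "length (b k) = ?n \<and> set (b k) \<subseteq> univ C" for k
  proof -
    have "range (?vs \<frown> e) \<subseteq> univ C" using e len by (auto simp: conc_def nth_append)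
    then show ?thesis by (simp add: b_def set_blk)
  qed
  have bG: "b k \<in> carrier ?G" if "k \<in> {2..8}" for k
  proof -
    have "par_holds C q (b k)" if "q \<in> tdg_type G" for q
      unfolding b_def by (rule bspec[OF eB]) (use that \<open>k \<in> {2..8}\<close> in blast)
    then show ?thesis using b_univ by (auto simp: carrier_tdg realizations_def)
  qed
  have bH: "b k \<in> carrier (tdg_group C H)" if "k \<in> {3..6}" for k
    using eQ b_univ that unfolding b_def
    by (auto simp: carrier_tdg realizations_def subgroup_dim[OF sub])
  have op: "b k = b i \<otimes>\<^bsub>?G\<^esub> b j"
    if ijk: "(i, j, k) \<in> {(3, 0, 7), (4, 2, 7), (5, 1, 8), (6, 2, 8)}" for i j k
  proof -
    have "?op (b i) (b j) (b k)"
      unfolding b_def by (rule bspec[OF eB]) (use ijk in blast)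
    moreover have "b i \<in> carrier ?G" "b j \<in> carrier ?G" "b k \<in> carrier ?G"
      using ijk bG b01 g h by auto
    ultimately show ?thesis by (simp add: tdg_op_iff[OF G])
  qed
  have carr: "b 2 \<in> carrier ?G" "b 3 \<in> carrier ?G" "b 4 \<in> carrier ?G" "b 5 \<in> carrier ?G"
    "b 6 \<in> carrier ?G" using bG by auto
  have eqs: "b 3 \<otimes>\<^bsub>?G\<^esub> g = b 4 \<otimes>\<^bsub>?G\<^esub> b 2" "b 5 \<otimes>\<^bsub>?G\<^esub> h = b 6 \<otimes>\<^bsub>?G\<^esub> b 2"
    using op[of 3 0 7] op[of 4 2 7] op[of 5 1 8] op[of 6 2 8] b01 by auto
  define p where "p = inv\<^bsub>?G\<^esub> b 3 \<otimes>\<^bsub>?G\<^esub> b 4"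
  define p' where "p' = inv\<^bsub>?G\<^esub> b 5 \<otimes>\<^bsub>?G\<^esub> b 6"
  have p: "p \<in> carrier ?G" "p' \<in> carrier ?G" using carr by (simp_all add: p_def p'_def)
  have "g = p \<otimes>\<^bsub>?G\<^esub> b 2" "h = p' \<otimes>\<^bsub>?G\<^esub> b 2"
    using eqs carr g h by (simp_all add: inv_solve_left m_assoc p_def p'_def)
  then have "g \<otimes>\<^bsub>?G\<^esub> inv\<^bsub>?G\<^esub> h = p \<otimes>\<^bsub>?G\<^esub> (b 2 \<otimes>\<^bsub>?G\<^esub> inv\<^bsub>?G\<^esub> b 2) \<otimes>\<^bsub>?G\<^esub> inv\<^bsub>?G\<^esub> p'"
    by (simp only: inv_mult_group m_assoc monoid.m_closed[OF monoid_axioms] inv_closed carr p)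
  also have "\<dots> = p \<otimes>\<^bsub>?G\<^esub> inv\<^bsub>?G\<^esub> p'" using carr p by simp
  also have "\<dots> \<in> carrier (tdg_group C H)"
    unfolding p_def p'_def using bH by (intro m_closed m_inv_closed) auto
  finally show ?thesis .
qed

text \<open>The index is counted in an elementary substructure, whereas cosets are compared in \<open>C\<close>. The
  two agree because products and quotients of elements of \<open>M\<close> stay in \<open>M\<close>.\<close>
lemma rcosets_elementary_eq:
  assumes G: "type_definable_group L \<kappa> C G" and H: "type_definable_group L \<kappa> C H"
    and sub: "tdg_subgroup C H G" and M: "elementary_substructure L M C"
    and par: "tdg_params G \<union> tdg_params H \<subseteq> univ M"
    and g: "g \<in> carrier (tdg_group M G)" and h: "h \<in> carrier (tdg_group M G)"
    and gh: "g \<otimes>\<^bsub>tdg_group C G\<^esub> inv\<^bsub>tdg_group C G\<^esub> h \<in> carrier (tdg_group C H)"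
  shows "carrier (tdg_group M H) #>\<^bsub>tdg_group M G\<^esub> g = carrier (tdg_group M H) #>\<^bsub>tdg_group M G\<^esub> h"
proof -
  let ?G = "tdg_group C G" and ?K = "carrier (tdg_group C H)"
  let ?GM = "tdg_group M G" and ?KM = "carrier (tdg_group M H)"
  interpret group ?G using G by (simp add: type_definable_group_def)
  interpret subgroup ?K ?G using sub by (simp add: tdg_subgroup_def)
  have carrM: "carrier ?GM = {a \<in> carrier ?G. set a \<subseteq> univ M}" "?KM = {a \<in> ?K. set a \<subseteq> univ M}"
    unfolding carrier_tdg using G H par
    by (auto simp: type_definable_group_def realizations_elementary[OF M])
  have closed: "set (a \<otimes>\<^bsub>?G\<^esub> b) \<subseteq> univ M" "set (b \<otimes>\<^bsub>?G\<^esub> inv\<^bsub>?G\<^esub> a) \<subseteq> univ M"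
    if "a \<in> carrier ?GM" "b \<in> carrier ?GM" for a b
    using group_closed_elementary[OF G M, of a b] that par unfolding carrM by auto
  have op: "tdg_op G \<in> par_formulas L (tdg_params G) (3 * tdg_dim G)"
    using G by (simp add: type_definable_group_def)
  have multM: "a \<otimes>\<^bsub>?GM\<^esub> b = a \<otimes>\<^bsub>?G\<^esub> b" if a: "a \<in> carrier ?GM" and b: "b \<in> carrier ?GM" for a b
  proof -
    have "(c \<in> carrier ?GM \<and> par_holds M (tdg_op G) (a @ b @ c)) \<longleftrightarrow> c = a \<otimes>\<^bsub>?G\<^esub> b" for c
    proof (cases "c \<in> carrier ?GM")
      case True
      have "length (a @ b @ c) = 3 * tdg_dim G" "set (a @ b @ c) \<subseteq> univ M"
        using a b True by (auto simp: carrier_tdg realizations_def)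
      then have "par_holds M (tdg_op G) (a @ b @ c) \<longleftrightarrow> par_holds C (tdg_op G) (a @ b @ c)"
        using par_holds_elementary[OF M op] par by blast
      then show ?thesis using True a b tdg_op_iff[OF G, of a b c] by (auto simp: carrM)
    next
      case False
      then show ?thesis using closed(1)[OF a b] a b by (auto simp: carrM)
    qed
    then show ?thesis by (simp add: tdg_group_def Let_def)
  qed
  have sub_coset: "?KM #>\<^bsub>?GM\<^esub> a \<subseteq> ?KM #>\<^bsub>?GM\<^esub> b"
    if a: "a \<in> carrier ?GM" and b: "b \<in> carrier ?GM" and ab: "a \<otimes>\<^bsub>?G\<^esub> inv\<^bsub>?G\<^esub> b \<in> ?K" for a b
  proof
    fix z assume "z \<in> ?KM #>\<^bsub>?GM\<^esub> a"
    then obtain k where k: "k \<in> ?KM" "z = k \<otimes>\<^bsub>?GM\<^esub> a" by (auto simp: r_coset_def)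
    have kG: "k \<in> carrier ?GM" using k(1) subset by (auto simp: carrM)
    let ?ab = "a \<otimes>\<^bsub>?G\<^esub> inv\<^bsub>?G\<^esub> b"
    have abM: "?ab \<in> carrier ?GM" using a b closed(2)[OF b a] by (simp add: carrM)
    have 1: "k \<otimes>\<^bsub>?G\<^esub> ?ab \<in> ?KM" using k(1) ab closed(1)[OF kG abM] by (simp add: carrM)
    have 2: "k \<otimes>\<^bsub>?G\<^esub> ?ab \<in> carrier ?GM" using 1 subset by (auto simp: carrM)
    have "z = k \<otimes>\<^bsub>?G\<^esub> a" using k(2) multM[OF kG a] by simp
    also have "\<dots> = (k \<otimes>\<^bsub>?G\<^esub> ?ab) \<otimes>\<^bsub>?G\<^esub> b" using kG a b by (simp add: m_assoc carrM)
    also have "\<dots> = (k \<otimes>\<^bsub>?G\<^esub> ?ab) \<otimes>\<^bsub>?GM\<^esub> b" using multM[OF 2 b] by simp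
    finally show "z \<in> ?KM #>\<^bsub>?GM\<^esub> b" using 1 by (auto simp: r_coset_def)
  qed
  have "h \<otimes>\<^bsub>?G\<^esub> inv\<^bsub>?G\<^esub> g = inv\<^bsub>?G\<^esub> (g \<otimes>\<^bsub>?G\<^esub> inv\<^bsub>?G\<^esub> h)"
    using g h by (simp add: inv_mult_group carrM)
  then have "h \<otimes>\<^bsub>?G\<^esub> inv\<^bsub>?G\<^esub> g \<in> ?K" using gh by simp
  then show ?thesis using sub_coset[OF g h gh] sub_coset[OF h g] by blast
qed

text \<open>If \<open>X \<Psi>\<close> is a finite maximal separated set for every \<open>\<Psi>\<close>, then every \<open>g\<close> is unseparated from
  some \<open>pick \<Psi> g\<close> in \<open>X \<Psi>\<close>, and by \<open>same_coset\<close> the function \<open>\<Psi> \<mapsto> pick \<Psi> g\<close> determines the coset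
  of \<open>g\<close>. The graphs of these functions are subsets of a set that is no larger than the set
  of formulas with parameters, and that set is small.\<close>
theorem unbounded_index_separated:
  assumes G: "type_definable_group L \<kappa> C G" and H: "type_definable_group L \<kappa> C H"
    and sub: "tdg_subgroup C H G" and unb: "unbounded_index L \<kappa> C G H"
  obtains \<Psi> X where "finite \<Psi>" "\<Psi> \<subseteq> tdg_type H" "infinite X" "X \<subseteq> carrier (tdg_group C G)"
    "\<And>g h. g \<in> X \<Longrightarrow> h \<in> X \<Longrightarrow> g \<noteq> h \<Longrightarrow> \<not> cosets_meet G \<Psi> g h"
proof (rule ccontr)
  assume no: "\<not> thesis"
  note found = that
  let ?G = "tdg_group C G" and ?S = "carrier (tdg_group C G)"
  interpret group ?G using G by (simp add: type_definable_group_def)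
  interpret subgroup "carrier (tdg_group C H)" ?G using sub by (simp add: tdg_subgroup_def)
  define FF where "FF = {\<Psi>. finite \<Psi> \<and> \<Psi> \<subseteq> tdg_type H}"
  define sep where "sep \<Psi> X \<longleftrightarrow> X \<subseteq> ?S \<and>
    (\<forall>g\<in>X. \<forall>h\<in>X. g \<noteq> h \<longrightarrow> \<not> cosets_meet G \<Psi> g h)" for \<Psi> X
  have fin: "finite X" if "\<Psi> \<in> FF" "sep \<Psi> X" for \<Psi> X
  proof (rule ccontr)
    assume "infinite X"
    then have thesis
      using that by (intro found[of \<Psi> X]) (auto simp: FF_def sep_def)
    then show False using no by blast
  qed
  have "\<exists>X. sep \<Psi> X \<and> (\<forall>Y. sep \<Psi> Y \<longrightarrow> X \<subseteq> Y \<longrightarrow> Y = X)" for \<Psi>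
  proof -
    have "\<exists>X\<in>Collect (sep \<Psi>). \<forall>Y\<in>Collect (sep \<Psi>). X \<subseteq> Y \<longrightarrow> Y = X"
    proof (rule subset_Zorn_nonempty)
      show "Collect (sep \<Psi>) \<noteq> {}" by (auto simp: sep_def intro: exI[of _ "{}"])
      fix \<C> assume \<C>: "subset.chain (Collect (sep \<Psi>)) \<C>"
      have "\<not> cosets_meet G \<Psi> g h" if gh: "g \<in> \<Union>\<C>" "h \<in> \<Union>\<C>" "g \<noteq> h" for g h
      proof -
        obtain X Y where XY: "X \<in> \<C>" "g \<in> X" "Y \<in> \<C>" "h \<in> Y" using gh by blast
        then have "X \<subseteq> Y \<or> Y \<subseteq> X" using \<C> by (auto simp: subset_chain_def)
        then obtain Z where "Z \<in> \<C>" "g \<in> Z" "h \<in> Z" using XY by blast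
        moreover from this have "sep \<Psi> Z" using \<C> by (auto simp: subset_chain_def)
        ultimately show ?thesis using gh(3) unfolding sep_def by blast
      qed
      moreover have "\<Union>\<C> \<subseteq> ?S" using \<C> unfolding subset_chain_def sep_def by blast
      ultimately show "\<Union>\<C> \<in> Collect (sep \<Psi>)" unfolding sep_def by blast
    qed
    then show ?thesis by blast
  qed
  then obtain X where X: "\<And>\<Psi>. sep \<Psi> (X \<Psi>)" "\<And>\<Psi> Y. sep \<Psi> Y \<Longrightarrow> X \<Psi> \<subseteq> Y \<Longrightarrow> Y = X \<Psi>"
    by metis
  have "\<exists>x\<in>X \<Psi>. cosets_meet G \<Psi> g x" if \<Psi>: "\<Psi> \<in> FF" and g: "g \<in> ?S" for \<Psi> g
  proof (cases "g \<in> X \<Psi>")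
    case True
    have "\<one>\<^bsub>?G\<^esub> \<in> realizations C (tdg_dim G) \<Psi>"
      using one_closed \<Psi> subgroup_dim[OF sub]
      by (auto simp: carrier_tdg[of C H] realizations_def FF_def)
    \<comment> \<open>Both multipliers are the identity.\<close>
    then show ?thesis using True by blast
  next
    case False
    show ?thesis
    proof (rule ccontr)
      assume far: "\<not> ?thesis"
      have "\<not> cosets_meet G \<Psi> x g \<and> \<not> cosets_meet G \<Psi> g x" if "x \<in> X \<Psi>" for x
        using far that by metis
      then have "sep \<Psi> (insert g (X \<Psi>))"
        using X(1)[of \<Psi>] g unfolding sep_def by blast
      then show False using X(2)[of \<Psi> "insert g (X \<Psi>)"] False by blast
    qed
  qed
  then obtain pick where pick: "\<And>\<Psi> g. \<Psi> \<in> FF \<Longrightarrow> g \<in> ?S \<Longrightarrow> pick \<Psi> g \<in> X \<Psi>"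
    "\<And>\<Psi> g. \<Psi> \<in> FF \<Longrightarrow> g \<in> ?S \<Longrightarrow> cosets_meet G \<Psi> g (pick \<Psi> g)"
    by metis
  let ?codes = "SIGMA \<Psi>:FF. X \<Psi>"
  define code where "code g = (\<lambda>\<Psi>. (\<Psi>, pick \<Psi> g)) ` FF" for g
  have code: "g \<otimes>\<^bsub>?G\<^esub> inv\<^bsub>?G\<^esub> h \<in> carrier (tdg_group C H)"
    if g: "g \<in> ?S" and h: "h \<in> ?S" and "code g = code h" for g h
  proof (rule same_coset[OF G H sub g h])
    fix \<Psi> assume "finite \<Psi>" "\<Psi> \<subseteq> tdg_type H"
    then have \<Psi>: "\<Psi> \<in> FF" by (simp add: FF_def)
    then have "(\<Psi>, pick \<Psi> g) \<in> code h" using that(3) unfolding code_def by blast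
    then have "pick \<Psi> h = pick \<Psi> g" unfolding code_def by auto
    then show "\<exists>x\<in>?S. cosets_meet G \<Psi> g x \<and> cosets_meet G \<Psi> h x"
      using pick[OF \<Psi> g] pick(2)[OF \<Psi> h] X(1)[of \<Psi>] unfolding sep_def
      by (intro bexI[of _ "pick \<Psi> g"]) auto
  qed
  obtain M where M: "elementary_substructure L M C" and par: "tdg_params G \<union> tdg_params H \<subseteq> univ M"
    and big: "\<kappa> \<le>o |rcosets\<^bsub>tdg_group M G\<^esub> (carrier (tdg_group M H))|"
    using unb[unfolded unbounded_index_def, rule_format, of \<kappa>] card
      ordLeq_reflexive[OF card_order_on_well_order_on[OF card]] by blast
  let ?R = "rcosets\<^bsub>tdg_group M G\<^esub> (carrier (tdg_group M H))"
  have "\<exists>g\<in>carrier (tdg_group M G). r = carrier (tdg_group M H) #>\<^bsub>tdg_group M G\<^esub> g" if "r \<in> ?R" for r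
    using that by (auto simp: RCOSETS_def)
  then obtain rep where rep: "\<And>r. r \<in> ?R \<Longrightarrow> rep r \<in> carrier (tdg_group M G)"
    "\<And>r. r \<in> ?R \<Longrightarrow> r = carrier (tdg_group M H) #>\<^bsub>tdg_group M G\<^esub> rep r"
    by metis
  have "carrier (tdg_group M G) \<subseteq> ?S"
    using realizations_elementary[OF M, of "tdg_type G" "tdg_params G" "tdg_dim G"] G par
    by (auto simp: carrier_tdg type_definable_group_def)
  then have repS: "rep r \<in> ?S" if "r \<in> ?R" for r using rep(1)[OF that] by blast
  have "inj_on (\<lambda>r. code (rep r)) ?R"
  proof (rule inj_onI)
    fix r s assume rs: "r \<in> ?R" "s \<in> ?R" "code (rep r) = code (rep s)"
    then have "rep r \<otimes>\<^bsub>?G\<^esub> inv\<^bsub>?G\<^esub> rep s \<in> carrier (tdg_group C H)"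
      by (intro code repS)
    then show "r = s"
      using rcosets_elementary_eq[OF G H sub M par] rep rs by metis
  qed
  moreover have "code (rep r) \<in> Pow ?codes" if "r \<in> ?R" for r
    using pick(1) repS[OF that] by (auto simp: code_def)
  ultimately have "|?R| \<le>o |Pow ?codes|"
    by (intro iffD1[OF card_of_ordLeq] exI[of _ "\<lambda>r. code (rep r)"]) auto
  moreover
  let ?B = "formulas L <+> tdg_params H"
  have B: "infinite ?B" using infinite_formulas by simp
  have "tdg_type H \<subseteq> par_formulas L (tdg_params H) (tdg_dim H)" and small_H: "small \<kappa> (tdg_params H)"
    using H by (auto simp: type_definable_group_def)
  then have "|tdg_type H| \<le>o |?B|"
    using card_of_mono1 card_of_par_formulas ordLeq_transitive by blast
  then have "|FF| \<le>o |?B|" unfolding FF_def using B by (rule card_of_finite_subsets_ordLeq[rotated])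
  then have "|?codes| \<le>o |?B|"
    using B fin X(1) by (intro card_of_Sigma_ordLeq_infinite) (auto intro: finite_ordLeq_infinite)
  then have "|Pow ?codes| \<le>o |Pow ?B|" by (rule card_of_Pow_ordLeq)
  moreover have "|Pow ?B| <o \<kappa>"
    using small_Plus[OF small_formulas small_H infinite_formulas] by (simp add: small_def)
  ultimately have "|?R| <o \<kappa>"
    by (meson ordLeq_ordLess_trans ordLeq_transitive)
  then show False using big not_ordLess_ordLeq by blast
qed

end

section \<open>Extraction of indiscernible arrays\<close>

text \<open>Ramsey's theorem for finitely many colorings with different exponents, applied to one
  coloring after the other. A finite set is represented by the increasing list of its
  elements, and the homogeneous set by its enumeration \<open>s\<close>.\<close>
lemma ramsey_increasing_lists:
  fixes F :: "(nat \<times> (nat list \<Rightarrow> bool)) set"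
  assumes "finite F"
  shows "\<exists>s :: nat \<Rightarrow> nat. strict_mono s \<and> (\<forall>(r, P)\<in>F. \<forall>xs ys. sorted_wrt (<) xs \<and>
    sorted_wrt (<) ys \<and> length xs = r \<and> length ys = r \<longrightarrow> P (map s xs) = P (map s ys))"
  using assms
proof (induction F)
  case empty
  show ?case by (auto intro: exI[of _ id] simp: strict_mono_def)
next
  case (insert rP F)
  obtain r P where rP: "rP = (r, P)" by force
  obtain s :: "nat \<Rightarrow> nat" where s: "strict_mono s" and s_hom: "\<forall>(r, P)\<in>F. \<forall>xs ys. sorted_wrt (<) xs \<and>
    sorted_wrt (<) ys \<and> length xs = r \<and> length ys = r \<longrightarrow> P (map s xs) = P (map s ys)"
    using insert.IH by (elim exE conjE)
  define f :: "nat set \<Rightarrow> nat" where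
    "f X = (if P (map s (sorted_list_of_set X)) then 1 else 0)" for X
  have "\<exists>Y t. Y \<subseteq> UNIV \<and> infinite Y \<and> t < 2 \<and> (\<forall>X. X \<subseteq> Y \<and> finite X \<and> card X = r \<longrightarrow> f X = t)"
    by (rule Ramsey) (auto simp: f_def)
  then obtain Y t where Y: "infinite Y"
    and Y_hom: "\<forall>X. X \<subseteq> Y \<and> finite X \<and> card X = r \<longrightarrow> f X = t" by (elim exE conjE)
  define g where "g = enumerate Y"
  have g: "strict_mono g" "range g \<subseteq> Y"
    using Y by (auto simp: g_def strict_mono_enumerate enumerate_in_set)
  have sorted_g: "sorted_wrt (<) (map g xs)" if "sorted_wrt (<) xs" for xs
    using that g(1) by (auto simp: sorted_wrt_map strict_mono_less)
  have P: "P (map (s \<circ> g) xs) \<longleftrightarrow> t = 1" if xs: "sorted_wrt (<) xs" "length xs = r" for xs :: "nat list"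
  proof -
    have sorted: "sorted_wrt (<) (map g xs)" by (rule sorted_g[OF xs(1)])
    then have "sorted (map g xs)" "distinct (map g xs)" by (simp_all add: strict_sorted_iff)
    then have "sorted_list_of_set (set (map g xs)) = map g xs" "card (set (map g xs)) = r"
      using xs(2) sorted_list_of_set.idem_if_sorted_distinct[of "map g xs"]
        distinct_card[of "map g xs"] by simp_all
    moreover have "set (map g xs) \<subseteq> Y" using g(2) by auto
    ultimately have "f (set (map g xs)) = t" using Y_hom by simp
    then show ?thesis
      using \<open>sorted_list_of_set (set (map g xs)) = map g xs\<close> by (auto simp: f_def split: if_splits)
  qed
  have hom: "P' (map (s \<circ> g) xs) = P' (map (s \<circ> g) ys)"
    if *: "(r', P') \<in> insert rP F" "sorted_wrt (<) xs" "sorted_wrt (<) ys"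
      "length xs = r'" "length ys = r'" for r' P' and xs ys :: "nat list"
  proof (cases "(r', P') = rP")
    case True
    then show ?thesis using P * rP by auto
  next
    case False
    then have "(r', P') \<in> F" using *(1) by simp
    with s_hom have "\<forall>xs ys. sorted_wrt (<) xs \<and> sorted_wrt (<) ys \<and> length xs = r' \<and>
        length ys = r' \<longrightarrow> P' (map s xs) = P' (map s ys)" by fast
    from spec[OF spec[OF this, of "map g xs"], of "map g ys"]
    show ?thesis using sorted_g[OF *(2)] sorted_g[OF *(3)] *(4,5) by simp
  qed
  moreover have "strict_mono (s \<circ> g)" using s g(1) by (auto simp: strict_mono_def)
  ultimately show ?case by (intro exI[of _ "s \<circ> g"]) blast
qed

text \<open>The variable that stands for the \<open>k\<close>-th entry of the tuple in row \<open>i\<close> and column \<open>j\<close>.\<close>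
definition var :: "nat \<Rightarrow> nat \<Rightarrow> nat \<Rightarrow> nat" where
  "var i j k = prod_encode (i, prod_encode (j, k))"

definition row :: "nat \<Rightarrow> nat" where "row v = fst (prod_decode v)"
definition col :: "nat \<Rightarrow> nat" where "col v = fst (prod_decode (snd (prod_decode v)))"
definition idx :: "nat \<Rightarrow> nat" where "idx v = snd (prod_decode (snd (prod_decode v)))"

lemma row_col_idx [simp]: "row (var i j k) = i" "col (var i j k) = j" "idx (var i j k) = k"
  by (simp_all add: var_def row_def col_def idx_def)

definition vars :: "(nat \<Rightarrow> nat) \<Rightarrow> nat \<Rightarrow> nat \<Rightarrow> nat list" where
  "vars N i j = map (var i j) [0..<N i]"

lemma length_vars [simp]: "length (vars N i j) = N i"
  by (simp add: vars_def)

lemma length_concat_vars [simp]: "length (concat (map (vars N i) js)) = length js * N i"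
  by (induction js) auto

context saturated_structure
begin

text \<open>In the rearranged array, column \<open>j\<close> of row \<open>i\<close> is filled from column \<open>s (i * q + j)\<close> of \<open>a\<close>. Let
  \<open>T ks\<close> list in increasing order all the numbers \<open>i * q + j\<close> that occur in the formula when row \<open>i0\<close>
  is used at the columns \<open>ks\<close> and the variables \<open>us\<close> belong to other rows. The numbers from
  row \<open>i0\<close> form a contiguous part of this list. Hence the position of each of the other numbers
  does not depend on \<open>ks\<close>, and the truth of the formula is a function \<open>Q\<close> of the list of
  columns of \<open>a\<close> alone.\<close>
lemma homogeneous_coloring:
  fixes a :: "nat \<Rightarrow> nat \<Rightarrow> 'm list"
  assumes us: "set us \<subseteq> (\<Union>i\<in>-{i0}. \<Union>j\<in>{..<q}. set (vars N i j))"
  shows "\<exists>m Q T.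
    (\<forall>ks. length ks = r \<and> sorted_wrt (<) ks \<and> set ks \<subseteq> {..<q} \<longrightarrow>
      sorted_wrt (<) (T ks) \<and> length (T ks) = m) \<and>
    (\<forall>ks s e. length ks = r \<and> (\<forall>i j. map e (vars N i j) = a i (s (i * q + j))) \<longrightarrow>
      holds C \<phi> (map e (concat (map (vars N i0) ks) @ us)) = Q (map s (T ks)))"
proof -
  define c where "c v = row v * q + col v" for v
  define lo where "lo = sorted_list_of_set {x \<in> c ` set us. x < i0 * q}"
  define hi where "hi = sorted_list_of_set {x \<in> c ` set us. i0 * q + q \<le> x}"
  define T where "T ks = lo @ map (\<lambda>j. i0 * q + j) ks @ hi" for ks
  have lo: "set lo = {x \<in> c ` set us. x < i0 * q}" "sorted_wrt (<) lo"
    and hi: "set hi = {x \<in> c ` set us. i0 * q + q \<le> x}" "sorted_wrt (<) hi"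
    by (simp_all add: lo_def hi_def)
  have us_var: "\<exists>i j k. v = var i j k \<and> i \<noteq> i0 \<and> j < q \<and> k < N i" if "v \<in> set us" for v
    using us that by (fastforce simp: vars_def)
  have lo_hi: "c v \<in> set lo \<union> set hi" if v: "v \<in> set us" for v
  proof -
    obtain i j k where ijk: "v = var i j k" "i \<noteq> i0" "j < q" using us_var[OF v] by blast
    have "i * q + j < i0 * q \<or> i0 * q + q \<le> i * q + j"
    proof (cases "i < i0")
      case True
      then have "(i + 1) * q \<le> i0 * q" by (intro mult_right_mono) auto
      then show ?thesis using ijk(3) by simp
    next
      case False
      then have "(i0 + 1) * q \<le> i * q" using ijk(2) by (intro mult_right_mono) auto
      then show ?thesis by simp
    qed
    then have "c v < i0 * q \<or> i0 * q + q \<le> c v" using ijk by (simp add: c_def)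
    then show ?thesis unfolding lo hi using v by blast
  qed
  have "\<exists>p. \<forall>ks. length ks = r \<longrightarrow> p < length (T ks) \<and> T ks ! p = c v" if v: "v \<in> set us" for v
  proof (cases "c v \<in> set lo")
    case True
    then obtain p where "p < length lo" "lo ! p = c v" by (auto simp: in_set_conv_nth)
    then show ?thesis by (intro exI[of _ p]) (auto simp: T_def nth_append)
  next
    case False
    then obtain p where "p < length hi" "hi ! p = c v"
      using lo_hi[OF v] by (auto simp: in_set_conv_nth)
    then show ?thesis by (intro exI[of _ "length lo + r + p"]) (auto simp: T_def nth_append)
  qed
  then obtain pos where pos: "\<And>v ks. v \<in> set us \<Longrightarrow> length ks = r \<Longrightarrow>
      pos v < length (T ks) \<and> T ks ! pos v = c v"
    by metis
  define Q where "Q xs = holds C \<phi> (concat (map (\<lambda>p. a i0 (xs ! (length lo + p))) [0..<r]) @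
      map (\<lambda>v. a (row v) (xs ! pos v) ! idx v) us)" for xs
  show ?thesis
  proof (rule exI[of _ "length lo + r + length hi"], rule exI[of _ Q], rule exI[of _ T],
      rule conjI; intro allI impI)
    fix ks assume ks: "length ks = r \<and> sorted_wrt (<) ks \<and> set ks \<subseteq> {..<q}"
    show "sorted_wrt (<) (T ks) \<and> length (T ks) = length lo + r + length hi"
      unfolding T_def sorted_wrt_append sorted_wrt_map
      using ks lo hi by (fastforce simp: sorted_wrt_map)
  next
    fix ks :: "nat list" and s :: "nat \<Rightarrow> nat" and e :: "nat \<Rightarrow> 'm"
    assume "length ks = r \<and> (\<forall>i j. map e (vars N i j) = a i (s (i * q + j)))"
    then have ks: "length ks = r" and e: "\<And>i j. map e (vars N i j) = a i (s (i * q + j))" by auto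
    have "map e (concat (map (vars N i0) ks)) = concat (map (\<lambda>k. a i0 (s (i0 * q + k))) ks)"
      by (simp add: map_concat e o_def)
    also have "map (\<lambda>k. a i0 (s (i0 * q + k))) ks =
        map (\<lambda>p. a i0 (map s (T ks) ! (length lo + p))) [0..<r]"
      using ks by (intro nth_equalityI) (auto simp: T_def nth_append)
    finally have 1: "map e (concat (map (vars N i0) ks)) =
        concat (map (\<lambda>p. a i0 (map s (T ks) ! (length lo + p))) [0..<r])" .
    have "e v = a (row v) (map s (T ks) ! pos v) ! idx v" if v: "v \<in> set us" for v
    proof -
      obtain i j k where ijk: "v = var i j k" "k < N i" using us_var[OF v] by blast
      have "e v = map e (vars N i j) ! k" using ijk by (simp add: vars_def)
      also have "\<dots> = a i (s (c v)) ! k" using ijk by (simp add: e c_def)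
      also have "s (c v) = map s (T ks) ! pos v" using pos[OF v ks] by simp
      finally show ?thesis using ijk by simp
    qed
    then have 2: "map e us = map (\<lambda>v. a (row v) (map s (T ks) ! pos v) ! idx v) us" by simp
    show "holds C \<phi> (map e (concat (map (vars N i0) ks) @ us)) = Q (map s (T ks))"
      unfolding Q_def map_append 1 2 ..
  qed
qed

text \<open>The conditions on the new array are the predicates in \<open>\<Theta>\<close> and the equivalences \<open>invariant\<close>,
  which state indiscernibility. Finitely many of them are satisfied by a rearrangement of \<open>a\<close>:
  take \<open>q\<close> larger than all the columns that occur, and \<open>s\<close> homogeneous for the colorings of
  \<open>homogeneous_coloring\<close>. The rearrangement uses increasing columns in every row, which is
  why \<open>\<Theta>\<close> has to hold for all such choices.\<close>
theorem extract_indiscernible_array: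
  fixes a :: "nat \<Rightarrow> nat \<Rightarrow> 'm list"
  assumes a: "\<And>i j. length (a i j) = N i \<and> set (a i j) \<subseteq> univ C"
    and def: "\<And>P. P \<in> \<Theta> \<Longrightarrow> definable {} P"
    and \<Theta>: "\<And>g e P. \<lbrakk>\<And>i. strict_mono (g i); range e \<subseteq> univ C;
      \<And>i j. map e (vars N i j) = a i (g i j); P \<in> \<Theta>\<rbrakk> \<Longrightarrow> P e"
  obtains e where "range e \<subseteq> univ C" "indiscernible_array L C {} (\<lambda>i j. map e (vars N i j))"
    "\<And>P. P \<in> \<Theta> \<Longrightarrow> P e"
proof -
  define others where "others i0 = (\<Union>i\<in>-{i0}. \<Union>j. set (vars N i j))" for i0
  define truth where "truth = (\<lambda>(i0, js :: nat list, us, \<phi>) e.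
    holds C \<phi> (map e (concat (map (vars N i0) js) @ us)))"
  define I :: "((nat \<times> nat list \<times> nat list \<times> ('f, 'r) fm) \<times> nat list) set" where
    "I = {((i0, js, us, \<phi>), js'). sorted_wrt (<) js \<and> sorted_wrt (<) js' \<and>
    length js = length js' \<and> set us \<subseteq> others i0 \<and> \<phi> \<in> formulas L \<and>
    fv \<phi> \<subseteq> {..<length js * N i0 + length us}}"
  define invariant where "invariant = (\<lambda>((i0, js, us, \<phi>), js') e. truth (i0, js, us, \<phi>) e = truth (i0, js', us, \<phi>) e)"
  have "\<exists>e. range e \<subseteq> univ C \<and> (\<forall>P\<in>\<Theta> \<union> invariant ` I. P e)"
  proof (rule saturated_assignments)
    show "{} \<subseteq> univ C" by simp
    show "|{}| <o \<kappa>" by (rule finite_less) simp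
    show "definable {} P" if "P \<in> \<Theta> \<union> invariant ` I" for P
      using that
    proof
      assume "P \<in> invariant ` I"
      then obtain i0 js us \<phi> js' where "P = invariant ((i0, js, us, \<phi>), js')"
        "length js = length js'" "\<phi> \<in> formulas L" "fv \<phi> \<subseteq> {..<length js * N i0 + length us}"
        by (auto simp: I_def)
      then show "definable {} P"
        unfolding invariant_def truth_def by (auto intro!: definable_iff definable_holds simp del: map_append)
    qed (rule def)
    fix F assume F: "finite F" "F \<subseteq> \<Theta> \<union> invariant ` I"
    then have "finite (F - \<Theta>)" "F - \<Theta> \<subseteq> invariant ` I" by auto
    then obtain I0 where I0: "finite I0" "I0 \<subseteq> I" "F - \<Theta> = invariant ` I0"
      using finite_subset_image[of "F - \<Theta>" invariant I] by auto
    have "finite (\<Union>((i0, js, us, \<phi>), js')\<in>I0. set js \<union> set js' \<union> col ` set us)"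
      using I0(1) by auto
    then obtain q where
      "\<forall>x\<in>\<Union>((i0, js, us, \<phi>), js')\<in>I0. set js \<union> set js' \<union> col ` set us. x < q"
      by (auto simp: finite_nat_set_iff_bounded)
    then have q: "set js \<subseteq> {..<q}" "set js' \<subseteq> {..<q}" "col ` set us \<subseteq> {..<q}"
      if "((i0, js, us, \<phi>), js') \<in> I0" for i0 js us \<phi> js'
      using that by force+
    define coloring where "coloring \<rho> mQ \<longleftrightarrow> (case \<rho> of ((i0, js, us, \<phi>), js') \<Rightarrow>
      (\<exists>T. (\<forall>ks\<in>{js, js'}. sorted_wrt (<) (T ks) \<and> length (T ks) = fst mQ) \<and>
        (\<forall>s e. (\<forall>i j. map e (vars N i j) = a i (s (i * q + j))) \<longrightarrow>
          (\<forall>ks\<in>{js, js'}. truth (i0, ks, us, \<phi>) e = snd mQ (map s (T ks))))))"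
      for \<rho> :: "(nat \<times> nat list \<times> nat list \<times> ('f, 'r) fm) \<times> nat list"
        and mQ :: "nat \<times> (nat list \<Rightarrow> bool)"
    have "\<exists>mQ. coloring \<rho> mQ" if "\<rho> \<in> I0" for \<rho>
    proof -
      obtain i0 js us \<phi> js' where \<rho>: "\<rho> = ((i0, js, us, \<phi>), js')" by (metis prod.exhaust)
      have "\<rho> \<in> I" using that I0(2) by blast
      then have js: "sorted_wrt (<) js" "sorted_wrt (<) js'" "length js' = length js"
        and us: "set us \<subseteq> others i0" by (auto simp: I_def \<rho>)
      have "set us \<subseteq> (\<Union>i\<in>-{i0}. \<Union>j\<in>{..<q}. set (vars N i j))"
      proof
        fix v assume v: "v \<in> set us"
        then obtain i j where "i \<noteq> i0" "v \<in> set (vars N i j)"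
          using us unfolding others_def by blast
        moreover from this have "j < q" using q(3)[of i0 js us \<phi> js'] that v \<rho> by (auto simp: vars_def)
        ultimately show "v \<in> (\<Union>i\<in>-{i0}. \<Union>j\<in>{..<q}. set (vars N i j))" by auto
      qed
      from homogeneous_coloring[OF this, where r = "length js" and a = a and \<phi> = \<phi>]
      obtain m Q T where T: "\<forall>ks. length ks = length js \<and> sorted_wrt (<) ks \<and> set ks \<subseteq> {..<q} \<longrightarrow>
          sorted_wrt (<) (T ks) \<and> length (T ks) = m"
        and Q: "\<forall>ks s e. length ks = length js \<and> (\<forall>i j. map e (vars N i j) = a i (s (i * q + j))) \<longrightarrow>
          holds C \<phi> (map e (concat (map (vars N i0) ks) @ us)) = Q (map s (T ks))"
        by (elim exE conjE)
      have "coloring \<rho> (m, Q)"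
        unfolding coloring_def \<rho> prod.case fst_conv snd_conv
      proof (intro exI[of _ T] conjI ballI allI impI)
        fix ks assume "ks \<in> {js, js'}"
        then show "sorted_wrt (<) (T ks)" "length (T ks) = m"
          using T js q[of i0 js us \<phi> js'] that \<rho> by auto
      next
        fix s e ks assume "\<forall>i j. map e (vars N i j) = a i (s (i * q + j))" "ks \<in> {js, js'}"
        then show "truth (i0, ks, us, \<phi>) e = Q (map s (T ks))"
          unfolding truth_def prod.case using js(3) by (intro Q[rule_format]) auto
      qed
      then show ?thesis by blast
    qed
    then obtain mQ where mQ: "\<And>\<rho>. \<rho> \<in> I0 \<Longrightarrow> coloring \<rho> (mQ \<rho>)" by metis
    obtain s :: "nat \<Rightarrow> nat" where s: "strict_mono s" "\<forall>(r, P)\<in>mQ ` I0. \<forall>xs ys.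
        sorted_wrt (<) xs \<and> sorted_wrt (<) ys \<and> length xs = r \<and> length ys = r \<longrightarrow>
        P (map s xs) = P (map s ys)"
      using ramsey_increasing_lists[of "mQ ` I0"] I0(1) by blast
    obtain u0 where u0: "u0 \<in> univ C" using univ_nonempty by blast
    define e where "e v = (if idx v < N (row v) then a (row v) (s (row v * q + col v)) ! idx v
      else u0)" for v
    have e_vars: "map e (vars N i j) = a i (s (i * q + j))" for i j
      using a[of i "s (i * q + j)"] by (auto simp: e_def vars_def intro!: nth_equalityI)
    have e_univ: "range e \<subseteq> univ C"
    proof safe
      fix v show "e v \<in> univ C"
        using a[of "row v" "s (row v * q + col v)"] u0 nth_mem[of "idx v"]
        unfolding e_def by (metis subsetD)
    qed
    have "P e" if "P \<in> F" for P
    proof (cases "P \<in> \<Theta>")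
      case True
      have "strict_mono (\<lambda>j. s (i * q + j))" for i
        using s(1) by (auto simp: strict_mono_def)
      then show ?thesis using \<Theta>[of "\<lambda>i j. s (i * q + j)" e P] e_univ e_vars True by blast
    next
      case False
      then have "P \<in> invariant ` I0" using that by (simp add: I0(3)[symmetric])
      then obtain \<rho> where \<rho>: "P = invariant \<rho>" "\<rho> \<in> I0" by (rule imageE)
      obtain i0 js us \<phi> js' where \<rho>': "\<rho> = ((i0, js, us, \<phi>), js')" by (metis prod.exhaust)
      obtain m Q where mQ': "mQ \<rho> = (m, Q)" by force
      have "coloring ((i0, js, us, \<phi>), js') (m, Q)"
        using mQ[OF \<rho>(2)] unfolding mQ' unfolding \<rho>' .
      from this[unfolded coloring_def prod.case fst_conv snd_conv] obtain T
        where T: "\<forall>ks\<in>{js, js'}. sorted_wrt (<) (T ks) \<and> length (T ks) = m"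
          and Q: "\<forall>s e. (\<forall>i j. map e (vars N i j) = a i (s (i * q + j))) \<longrightarrow>
            (\<forall>ks\<in>{js, js'}. truth (i0, ks, us, \<phi>) e = Q (map s (T ks)))"
        by (elim exE conjE)
      have truth_e: "\<forall>ks\<in>{js, js'}. truth (i0, ks, us, \<phi>) e = Q (map s (T ks))"
        by (rule Q[THEN spec, THEN spec, THEN mp]) (simp add: e_vars)
      have mQ_in: "(m, Q) \<in> mQ ` I0" using \<rho>(2) mQ' by force
      have "\<forall>xs ys. sorted_wrt (<) xs \<and> sorted_wrt (<) ys \<and> length xs = m \<and> length ys = m \<longrightarrow>
          Q (map s xs) = Q (map s ys)"
        using bspec[OF s(2) mQ_in] by simp
      then have "Q (map s (T js)) = Q (map s (T js'))" using T by simp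
      then show ?thesis unfolding \<rho>(1) \<rho>' invariant_def prod.case using truth_e by simp
    qed
    then show "\<exists>e. range e \<subseteq> univ C \<and> (\<forall>P\<in>F. P e)" using e_univ by blast
  qed
  then obtain e where e: "range e \<subseteq> univ C" and all: "\<forall>P\<in>\<Theta> \<union> invariant ` I. P e"
    by (elim exE conjE)
  have e_\<Theta>: "P e" if "P \<in> \<Theta>" for P using bspec[OF all, of P] that by simp
  have e_ind: "invariant \<rho> e" if "\<rho> \<in> I" for \<rho> using bspec[OF all, of "invariant \<rho>"] that by simp
  have "indiscernible_array L C {} (\<lambda>i j. map e (vars N i j))"
    unfolding indiscernible_array_def indiscernible_def
  proof (intro allI conjI impI)
    fix i0 j
    show "length (map e (vars N i0 j)) = length (map e (vars N i0 0))" by simp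
    show "set (map e (vars N i0 j)) \<subseteq> univ C" using e by auto
  next
    fix i0 and js js' :: "nat list" and \<phi> d
    assume *: "sorted_wrt (<) js \<and> sorted_wrt (<) js' \<and> length js = length js' \<and>
      (\<phi>, d) \<in> par_formulas L ({} \<union> (\<Union>i\<in>- {i0}. \<Union>j. set (map e (vars N i j))))
        (length js * length (map e (vars N i0 0)))"
    then have "set d \<subseteq> (\<Union>i\<in>- {i0}. \<Union>j. set (map e (vars N i j)))"
      by (simp add: par_formulas_def)
    also have "\<dots> = e ` others i0" by (auto simp: others_def)
    finally have d: "set d \<subseteq> e ` others i0" .
    define us where "us = map (inv_into (others i0) e) d"
    have us: "set us \<subseteq> others i0" "d = map e us"
      using d by (auto simp: us_def inv_into_into f_inv_into_f subset_iff intro!: map_idI[symmetric])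
    have "((i0, js, us, \<phi>), js') \<in> I"
      using * us by (auto simp: I_def par_formulas_def)
    from e_ind[OF this] show "par_holds C (\<phi>, d) (concat (map (\<lambda>j. map e (vars N i0 j)) js)) \<longleftrightarrow>
      par_holds C (\<phi>, d) (concat (map (\<lambda>j. map e (vars N i0 j)) js'))"
      by (simp add: invariant_def truth_def par_holds_def us(2) map_concat o_def)
  qed
  then show thesis using that e e_\<Theta> by blast
qed

end

section \<open>Descending chains of groups\<close>

context saturated_structure
begin

text \<open>The definable form of \<open>t = y k \<dots> y 0\<close> in \<open>G\<close>, when \<open>\<Delta>\<close> is exact.\<close>
primrec prod_rel ::
  "('f, 'r, 'm) tdgroup \<Rightarrow> (('f, 'r) fm \<times> 'm list) set \<Rightarrow> nat \<Rightarrow> (nat \<Rightarrow> 'm list) \<Rightarrow> 'm list \<Rightarrow> bool"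
where
  "prod_rel G \<Delta> 0 y t \<longleftrightarrow> t = y 0"
| "prod_rel G \<Delta> (Suc k) y t \<longleftrightarrow>
     (\<exists>s. length s = tdg_dim G \<and> set s \<subseteq> univ C \<and> prod_rel G \<Delta> k y s \<and>
        (\<forall>q\<in>\<Delta>. par_holds C q t) \<and> par_holds C (tdg_op G) (y (Suc k) @ s @ t))"

lemma prod_rel_cong:
  "(\<And>i. i \<le> k \<Longrightarrow> y i = y' i) \<Longrightarrow> prod_rel G \<Delta> k y t \<longleftrightarrow> prod_rel G \<Delta> k y' t"
  by (induction k arbitrary: t) auto

text \<open>The definable form of the statement that \<open>x (y k \<dots> y 0)\<^sup>-\<^sup>1\<close> satisfies \<open>\<Psi>\<close>.\<close>
definition quot_rel ::
  "('f, 'r, 'm) tdgroup \<Rightarrow> (('f, 'r) fm \<times> 'm list) set \<Rightarrow> (('f, 'r) fm \<times> 'm list) set \<Rightarrow>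
     nat \<Rightarrow> 'm list \<Rightarrow> (nat \<Rightarrow> 'm list) \<Rightarrow> bool" where
  "quot_rel G \<Delta> \<Psi> k x y \<longleftrightarrow>
     (\<exists>t. length t = tdg_dim G \<and> set t \<subseteq> univ C \<and> prod_rel G \<Delta> k y t \<and>
       (\<exists>u. length u = tdg_dim G \<and> set u \<subseteq> univ C \<and> (\<forall>q\<in>\<Delta> \<union> \<Psi>. par_holds C q u) \<and>
          par_holds C (tdg_op G) (u @ t @ x)))"

lemma definable_par_holds3:
  assumes "q \<in> par_formulas L A (3 * n)" "length us = n" "length vs = n" "length ws = n"
  shows "definable A (\<lambda>e. par_holds C q (map e us @ map e vs @ map e ws))"
  using definable_par_holds[OF assms(1), of "us @ vs @ ws"] assms by simp

lemma definable_prod_rel: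
  assumes \<Delta>: "finite \<Delta>" "\<Delta> \<subseteq> par_formulas L A (tdg_dim G)"
    and op: "tdg_op G \<in> par_formulas L A (3 * tdg_dim G)"
    and us: "\<And>i. length (us i) = tdg_dim G" and ws: "length ws = tdg_dim G"
  shows "definable A (\<lambda>e. prod_rel G \<Delta> k (\<lambda>i. map e (us i)) (map e ws))"
  using us ws
proof (induction k arbitrary: us ws)
  case 0
  then show ?case by (auto intro: definable_eq_tuple)
next
  case (Suc k)
  let ?n = "tdg_dim G"
  let ?sh = "map (\<lambda>j. j + ?n)"
  have sh: "map (\<lambda>i. e (i + ?n)) vs = map e (?sh vs)" for e :: "nat \<Rightarrow> 'm" and vs by simp
  show ?case
    unfolding prod_rel.simps
  proof (rule definable_Ex_tuple, unfold sh, intro definable_And definable_Ball \<Delta>(1))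
    show "definable A (\<lambda>e. prod_rel G \<Delta> k (\<lambda>i. map e (?sh (us i))) (map e [0..<?n]))"
      by (rule Suc.IH) (use Suc.prems in auto)
    show "definable A (\<lambda>e. par_holds C q (map e (?sh ws)))" if "q \<in> \<Delta>" for q
      using that \<Delta>(2) Suc.prems by (intro definable_par_holds[of q A ?n]) auto
    show "definable A (\<lambda>e. par_holds C (tdg_op G)
        (map e (?sh (us (Suc k))) @ map e [0..<?n] @ map e (?sh ws)))"
      using Suc.prems by (intro definable_par_holds3[OF op]) auto
  qed
qed

lemma definable_quot_rel:
  assumes \<Delta>: "finite \<Delta>" "\<Delta> \<subseteq> par_formulas L A (tdg_dim G)"
    and \<Psi>: "finite \<Psi>" "\<Psi> \<subseteq> par_formulas L A (tdg_dim G)"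
    and op: "tdg_op G \<in> par_formulas L A (3 * tdg_dim G)"
    and us: "\<And>i. length (us i) = tdg_dim G" and ws: "length ws = tdg_dim G"
  shows "definable A (\<lambda>e. quot_rel G \<Delta> \<Psi> k (map e ws) (\<lambda>i. map e (us i)))"
proof -
  let ?n = "tdg_dim G"
  let ?sh = "map (\<lambda>j. j + ?n)"
  have sh: "map (\<lambda>i. e (i + ?n)) vs = map e (?sh vs)" for e :: "nat \<Rightarrow> 'm" and vs by simp
  show ?thesis
    unfolding quot_rel_def
  proof (rule definable_Ex_tuple, unfold sh, rule definable_And)
    show "definable A (\<lambda>e. prod_rel G \<Delta> k (\<lambda>i. map e (?sh (us i))) (map e [0..<?n]))"
      using \<Delta> op us by (intro definable_prod_rel) auto
    show "definable A (\<lambda>e. \<exists>u. length u = ?n \<and> set u \<subseteq> univ C \<and>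
        (\<forall>q\<in>\<Delta> \<union> \<Psi>. par_holds C q u) \<and>
        par_holds C (tdg_op G) (u @ map e [0..<?n] @ map e (?sh ws)))"
    proof (rule definable_Ex_tuple, unfold sh, intro definable_And definable_Ball)
      show "definable A (\<lambda>e. par_holds C q (map e [0..<?n]))" if "q \<in> \<Delta> \<union> \<Psi>" for q
        using that \<Delta>(2) \<Psi>(2) by (intro definable_par_holds[of q A ?n]) auto
      show "definable A (\<lambda>e. par_holds C (tdg_op G)
          (map e [0..<?n] @ map e (?sh [0..<?n]) @ map e (?sh (?sh ws))))"
        using ws by (intro definable_par_holds3[OF op]) auto
    qed (use \<Delta>(1) \<Psi>(1) in simp)
  qed
qed

end

text \<open>The product \<open>y (k - 1) \<dots> y 0\<close>, with later factors on the left so that all the factors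
  beyond a given one can be split off towards the smaller groups.\<close>
primrec tail_prod :: "('a, 'b) monoid_scheme \<Rightarrow> (nat \<Rightarrow> 'a) \<Rightarrow> nat \<Rightarrow> 'a" where
  "tail_prod G y 0 = \<one>\<^bsub>G\<^esub>"
| "tail_prod G y (Suc k) = y k \<otimes>\<^bsub>G\<^esub> tail_prod G y k"

lemma tail_prod_cong:
  "(\<And>i. i < k \<Longrightarrow> y i = y' i) \<Longrightarrow> tail_prod G y k = tail_prod G y' k"
  by (induction k) auto

lemma (in monoid) tail_prod_closed:
  "(\<And>i. i < k \<Longrightarrow> y i \<in> carrier G) \<Longrightarrow> tail_prod G y k \<in> carrier G"
  by (induction k) auto

context saturated_structure
begin

lemma quot_rel_iff:
  assumes G: "type_definable_group L \<kappa> C G" and \<Delta>: "exact_formulas G \<Delta>"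
    and y: "\<And>i. i \<le> k \<Longrightarrow> y i \<in> carrier (tdg_group C G)" and x: "x \<in> carrier (tdg_group C G)"
  shows "quot_rel G \<Delta> \<Psi> k x y \<longleftrightarrow>
    x \<otimes>\<^bsub>tdg_group C G\<^esub> inv\<^bsub>tdg_group C G\<^esub> tail_prod (tdg_group C G) y (Suc k) \<in> realizations C (tdg_dim G) \<Psi>"
proof -
  let ?G = "tdg_group C G" and ?n = "tdg_dim G"
  interpret group ?G using G by (simp add: type_definable_group_def)
  have real: "c \<in> realizations C ?n \<Delta>" "length c = ?n" "set c \<subseteq> univ C" if "c \<in> carrier ?G" for c
    using that \<Delta> unfolding exact_formulas_def carrier_tdg realizations_def by blast+
  have mult: "t \<in> realizations C ?n \<Delta> \<and> par_holds C (tdg_op G) (a @ b @ t) \<longleftrightarrow> t = a \<otimes>\<^bsub>?G\<^esub> b"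
    if "a \<in> carrier ?G" "b \<in> carrier ?G" for a b t
    using \<Delta> that real(1)[of t] unfolding exact_formulas_def by (metis m_closed real(1))
  have quot: "u \<in> realizations C ?n \<Delta> \<and> par_holds C (tdg_op G) (u @ a @ b) \<longleftrightarrow>
      u = b \<otimes>\<^bsub>?G\<^esub> inv\<^bsub>?G\<^esub> a" if "a \<in> carrier ?G" "b \<in> carrier ?G" for a b u
    using \<Delta> that unfolding exact_formulas_def by (metis m_closed inv_closed real(1))
  have prod: "length t = ?n \<and> set t \<subseteq> univ C \<and> prod_rel G \<Delta> k y t \<longleftrightarrow> t = tail_prod ?G y (Suc k)"
    for t
    using y
  proof (induction k arbitrary: t)
    case 0
    then show ?case using real[of "y 0"] by auto
  next
    case (Suc k)
    let ?p = "tail_prod ?G y (Suc k)"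
    have p: "?p \<in> carrier ?G" using Suc.prems by (intro tail_prod_closed) auto
    have IH: "length s = ?n \<and> set s \<subseteq> univ C \<and> prod_rel G \<Delta> k y s \<longleftrightarrow> s = ?p" for s
      by (rule Suc.IH) (use Suc.prems in auto)
    have "length t = ?n \<and> set t \<subseteq> univ C \<and> prod_rel G \<Delta> (Suc k) y t \<longleftrightarrow>
        (\<exists>s. (length s = ?n \<and> set s \<subseteq> univ C \<and> prod_rel G \<Delta> k y s) \<and>
          t \<in> realizations C ?n \<Delta> \<and> par_holds C (tdg_op G) (y (Suc k) @ s @ t))"
      unfolding prod_rel.simps realizations_def by blast
    also have "\<dots> \<longleftrightarrow> t \<in> realizations C ?n \<Delta> \<and> par_holds C (tdg_op G) (y (Suc k) @ ?p @ t)"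
      unfolding IH by simp
    also have "\<dots> \<longleftrightarrow> t = y (Suc k) \<otimes>\<^bsub>?G\<^esub> ?p" using Suc.prems p by (intro mult) auto
    finally show ?case by simp
  qed
  let ?p = "tail_prod ?G y (Suc k)"
  have p: "?p \<in> carrier ?G" using y by (intro tail_prod_closed) auto
  have "quot_rel G \<Delta> \<Psi> k x y \<longleftrightarrow>
      (\<exists>t. (length t = ?n \<and> set t \<subseteq> univ C \<and> prod_rel G \<Delta> k y t) \<and>
        (\<exists>u. u \<in> realizations C ?n \<Psi> \<and>
          (u \<in> realizations C ?n \<Delta> \<and> par_holds C (tdg_op G) (u @ t @ x))))"
    unfolding quot_rel_def realizations_def by blast
  also have "\<dots> \<longleftrightarrow> (\<exists>u. u \<in> realizations C ?n \<Psi> \<and>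
      (u \<in> realizations C ?n \<Delta> \<and> par_holds C (tdg_op G) (u @ ?p @ x)))"
    unfolding prod by simp
  finally have "quot_rel G \<Delta> \<Psi> k x y \<longleftrightarrow> (\<exists>u. u \<in> realizations C ?n \<Psi> \<and>
      (u \<in> realizations C ?n \<Delta> \<and> par_holds C (tdg_op G) (u @ ?p @ x)))" .
  then show ?thesis using quot[OF p x] by auto
qed

lemma chain_subgroup:
  assumes G: "\<And>i. type_definable_group L \<kappa> C (G i)" and sub: "\<And>i. tdg_subgroup C (G (Suc i)) (G i)"
  shows "subgroup (carrier (tdg_group C (G i))) (tdg_group C (G 0))"
    and "a \<in> carrier (tdg_group C (G i)) \<Longrightarrow> b \<in> carrier (tdg_group C (G i)) \<Longrightarrow>
      a \<otimes>\<^bsub>tdg_group C (G i)\<^esub> b = a \<otimes>\<^bsub>tdg_group C (G 0)\<^esub> b"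
proof -
  let ?T = "\<lambda>i. tdg_group C (G i)"
  have grp: "group (?T i)" for i using G by (simp add: type_definable_group_def)
  interpret G0: group "?T 0" by (rule grp)
  have "subgroup (carrier (?T i)) (?T 0) \<and>
    (\<forall>a\<in>carrier (?T i). \<forall>b\<in>carrier (?T i). a \<otimes>\<^bsub>?T i\<^esub> b = a \<otimes>\<^bsub>?T 0\<^esub> b)"
  proof (induction i)
    case 0
    then show ?case by (simp add: G0.subgroup_self)
  next
    case (Suc i)
    interpret Gi: group "?T i" by (rule grp)
    interpret H: group "?T (Suc i)" by (rule grp)
    interpret K: subgroup "carrier (?T (Suc i))" "?T i" using sub by (simp add: tdg_subgroup_def)
    have carr: "carrier (?T (Suc i)) \<subseteq> carrier (?T 0)"
      using K.subset Suc subgroup.subset by blast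
    have mult: "a \<otimes>\<^bsub>?T (Suc i)\<^esub> b = a \<otimes>\<^bsub>?T 0\<^esub> b"
      if ab: "a \<in> carrier (?T (Suc i))" "b \<in> carrier (?T (Suc i))" for a b
    proof -
      have "a \<otimes>\<^bsub>?T (Suc i)\<^esub> b = a \<otimes>\<^bsub>?T i\<^esub> b" using ab sub[of i] by (simp add: tdg_subgroup_def)
      also have "\<dots> = a \<otimes>\<^bsub>?T 0\<^esub> b" using ab Suc K.subset by blast
      finally show ?thesis .
    qed
    let ?one = "\<one>\<^bsub>?T (Suc i)\<^esub>"
    have "?one \<otimes>\<^bsub>?T 0\<^esub> ?one = ?one" using mult[of ?one ?one] by simp
    moreover have "?one \<in> carrier (?T 0)" using carr H.one_closed by blast
    ultimately have one: "?one = \<one>\<^bsub>?T 0\<^esub>" using G0.l_cancel_one by blast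
    have "subgroup (carrier (?T (Suc i))) (?T 0)"
    proof (rule G0.subgroupI)
      show "carrier (?T (Suc i)) \<noteq> {}" using H.one_closed by blast
      show "inv\<^bsub>?T 0\<^esub> a \<in> carrier (?T (Suc i))" if a: "a \<in> carrier (?T (Suc i))" for a
      proof -
        have "inv\<^bsub>?T (Suc i)\<^esub> a \<otimes>\<^bsub>?T 0\<^esub> a = \<one>\<^bsub>?T 0\<^esub>"
          using mult[of "inv\<^bsub>?T (Suc i)\<^esub> a" a] a one by simp
        then have "inv\<^bsub>?T 0\<^esub> a = inv\<^bsub>?T (Suc i)\<^esub> a"
          using a carr H.inv_closed[OF a] by (intro G0.inv_equality) auto
        then show ?thesis using a by simp
      qed
    qed (use carr mult H.m_closed in auto)
    then show ?case using mult by blast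
  qed
  then show "subgroup (carrier (?T i)) (?T 0)"
    "a \<in> carrier (?T i) \<Longrightarrow> b \<in> carrier (?T i) \<Longrightarrow> a \<otimes>\<^bsub>?T i\<^esub> b = a \<otimes>\<^bsub>?T 0\<^esub> b" by blast+
qed

end

lemma nth_append_swap:
  assumes "length xs = p" "length ys = r" "length zs = s" "v < p + r + s"
  shows "(xs @ zs @ ys) ! (if v < p then v else if v < p + r then v + s else v - r) =
    (xs @ ys @ zs) ! v"
proof -
  consider "v < p" | k where "v = p + k" "k < r" | k where "v = p + r + k" "k < s"
    using assms(4) by (metis add.assoc add_less_cancel_left le_iff_add not_less)
  then show ?thesis using assms by cases (auto simp: nth_append)
qed

context saturated_structure
begin

lemma quot_rel_cong:
  assumes "\<And>i. i \<le> k \<Longrightarrow> y i = y' i"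
  shows "quot_rel G \<Delta> \<Psi> k x y \<longleftrightarrow> quot_rel G \<Delta> \<Psi> k x y'"
  unfolding quot_rel_def using prod_rel_cong[of k y y'] assms by auto

lemma chain_antimono:
  assumes sub: "\<And>i. tdg_subgroup C (G (Suc i)) (G i)" and "i \<le> j"
  shows "carrier (tdg_group C (G j)) \<subseteq> carrier (tdg_group C (G i))"
  by (rule lift_Suc_antimono_le[OF _ \<open>i \<le> j\<close>])
    (use sub in \<open>auto simp: tdg_subgroup_def dest: subgroup.subset\<close>)

lemma chain_dim:
  assumes "\<And>i. tdg_subgroup C (G (Suc i)) (G i)"
  shows "tdg_dim (G i) = tdg_dim (G 0)"
  by (induction i) (simp_all add: subgroup_dim[OF assms])

text \<open>Write \<open>x = w (y i) p\<close> with \<open>p = y (i - 1) \<dots> y 0\<close> and \<open>w = y m \<dots> y (i + 1)\<close>. The quotient of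
  \<open>x\<close> by \<open>y i p\<close> is \<open>w\<close>, which lies in \<open>G (Suc i)\<close> and hence satisfies \<open>\<Psi>\<close>. If the quotient \<open>u\<close> of
  \<open>x\<close> by \<open>h p\<close> satisfied \<open>\<Psi>\<close> too, then \<open>u h = w (y i)\<close> would contradict the separation of
  \<open>h\<close> and \<open>y i\<close>.\<close>
lemma chain_quotients:
  assumes G: "\<And>i. type_definable_group L \<kappa> C (G i)" and sub: "\<And>i. tdg_subgroup C (G (Suc i)) (G i)"
    and \<Delta>: "exact_formulas (G 0) \<Delta>" and \<Psi>: "\<Psi> \<subseteq> tdg_type (G (Suc i))"
    and y: "\<And>k. y k \<in> carrier (tdg_group C (G k))" and "i \<le> m"
    and x: "x = tail_prod (tdg_group C (G 0)) y (Suc m)"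
  shows "quot_rel (G 0) \<Delta> \<Psi> i x y"
    and "h \<in> carrier (tdg_group C (G i)) \<Longrightarrow> \<not> cosets_meet (G i) \<Psi> h (y i) \<Longrightarrow>
      \<not> quot_rel (G 0) \<Delta> \<Psi> i x (y(i := h))"
proof -
  let ?T = "\<lambda>i. tdg_group C (G i)" and ?n = "tdg_dim (G 0)"
  interpret group "?T 0" using G by (simp add: type_definable_group_def)
  note anti = chain_antimono[of G, OF sub]
  have y0: "y k \<in> carrier (?T 0)" for k using y[of k] anti[of 0 k] by blast
  have p0: "tail_prod (?T 0) y k \<in> carrier (?T 0)" for k by (intro tail_prod_closed y0)
  have x0: "x \<in> carrier (?T 0)" unfolding x by (rule p0)
  have sg: "subgroup (carrier (?T k)) (?T 0)" for k by (rule chain_subgroup(1)[of G, OF G sub])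
  let ?p = "tail_prod (?T 0) y"
  have quot_mem: "?p (Suc j) \<otimes>\<^bsub>?T 0\<^esub> inv\<^bsub>?T 0\<^esub> ?p (Suc i) \<in> carrier (?T (Suc i))" if "i \<le> j" for j
    using that
  proof (induction j rule: dec_induct)
    case base
    show ?case using p0[of "Suc i"] subgroup.one_closed[OF sg] by (simp del: tail_prod.simps)
  next
    case (step j)
    have "?p (Suc (Suc j)) \<otimes>\<^bsub>?T 0\<^esub> inv\<^bsub>?T 0\<^esub> ?p (Suc i) =
        y (Suc j) \<otimes>\<^bsub>?T 0\<^esub> (?p (Suc j) \<otimes>\<^bsub>?T 0\<^esub> inv\<^bsub>?T 0\<^esub> ?p (Suc i))"
      using p0[of "Suc j"] p0[of "Suc i"] y0[of "Suc j"]
      by (simp add: m_assoc tail_prod.simps(2)[of _ _ "Suc j"] del: tail_prod.simps)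
    moreover have "y (Suc j) \<in> carrier (?T (Suc i))"
      using y[of "Suc j"] anti[of "Suc i" "Suc j"] step(1) by auto
    ultimately show ?case using step.IH subgroup.m_closed[OF sg] by simp
  qed
  let ?w = "x \<otimes>\<^bsub>?T 0\<^esub> inv\<^bsub>?T 0\<^esub> ?p (Suc i)"
  have w: "?w \<in> carrier (?T (Suc i))" unfolding x by (rule quot_mem[OF \<open>i \<le> m\<close>])
  then have w_real: "?w \<in> realizations C ?n \<Psi>"
    using \<Psi> chain_dim[of G "Suc i", OF sub] by (auto simp: carrier_tdg realizations_def)
  show "quot_rel (G 0) \<Delta> \<Psi> i x y"
    using w_real by (subst quot_rel_iff[OF G \<Delta> y0 x0])
  assume h: "h \<in> carrier (?T i)" and far: "\<not> cosets_meet (G i) \<Psi> h (y i)"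
  have h0: "h \<in> carrier (?T 0)" using h anti[of 0 i] by blast
  show "\<not> quot_rel (G 0) \<Delta> \<Psi> i x (y(i := h))"
  proof
    assume "quot_rel (G 0) \<Delta> \<Psi> i x (y(i := h))"
    moreover have "tail_prod (?T 0) (y(i := h)) (Suc i) = h \<otimes>\<^bsub>?T 0\<^esub> ?p i"
      using tail_prod_cong[of i "y(i := h)" y "?T 0"] by simp
    moreover have "(y(i := h)) k \<in> carrier (?T 0)" for k using y0 h0 by simp
    ultimately have u_real: "x \<otimes>\<^bsub>?T 0\<^esub> inv\<^bsub>?T 0\<^esub> (h \<otimes>\<^bsub>?T 0\<^esub> ?p i) \<in> realizations C ?n \<Psi>"
      using quot_rel_iff[OF G \<Delta>, of i "y(i := h)" x \<Psi>] x0 by simp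
    define u where "u = x \<otimes>\<^bsub>?T 0\<^esub> inv\<^bsub>?T 0\<^esub> (h \<otimes>\<^bsub>?T 0\<^esub> ?p i)"
    define z where "z = x \<otimes>\<^bsub>?T 0\<^esub> inv\<^bsub>?T 0\<^esub> ?p i"
    have z: "z \<in> carrier (?T 0)" using x0 p0 by (simp add: z_def)
    have u_eq: "u = z \<otimes>\<^bsub>?T 0\<^esub> inv\<^bsub>?T 0\<^esub> h" and w_eq: "?w = z \<otimes>\<^bsub>?T 0\<^esub> inv\<^bsub>?T 0\<^esub> y i"
      using x0 h0 y0 p0[of i] by (simp_all add: u_def z_def inv_mult_group m_assoc)
    have uh: "u \<otimes>\<^bsub>?T 0\<^esub> h = z" and wy: "?w \<otimes>\<^bsub>?T 0\<^esub> y i = z"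
      unfolding u_eq w_eq using z h0 y0 by (simp_all add: m_assoc)
    have w_i: "?w \<in> carrier (?T i)" using w anti[of i "Suc i"] by auto
    then have "?w \<otimes>\<^bsub>?T 0\<^esub> y i \<in> carrier (?T i)"
      using y[of i] subgroup.m_closed[OF sg] by blast
    then have u_i: "u \<in> carrier (?T i)"
      unfolding u_eq wy using h subgroup.m_closed[OF sg] subgroup.m_inv_closed[OF sg] by blast
    note mult = chain_subgroup(2)[of G, OF G sub, of _ i]
    have "u \<otimes>\<^bsub>?T i\<^esub> h = ?w \<otimes>\<^bsub>?T i\<^esub> y i"
      using uh wy mult[OF u_i h] mult[OF w_i y] by simp
    then have "cosets_meet (G i) \<Psi> h (y i)"
      using u_i w_i u_real[folded u_def] w_real chain_dim[of G i, OF sub] by auto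
    then show False using far by blast
  qed
qed

text \<open>Row \<open>i\<close> of the array consists of separated elements \<open>\<alpha> i j\<close> of \<open>G i\<close>, each followed by the
  parameters \<open>c i\<close> of the formula of level \<open>i\<close>, and the formula \<open>\<phi> i\<close> reads its parameters from
  there. The parameters may then vary with the array that is extracted, and the condition
  \<open>\<Theta> m\<close>, that a single \<open>x\<close> distinguishes the first two columns in all the rows up to \<open>m\<close>, is a
  formula without parameters.\<close>
theorem no_unbounded_chain:
  assumes s2: "strongly2_dependent L C"
    and G: "\<And>i. type_definable_group L \<kappa> C (G i)" and sub: "\<And>i. tdg_subgroup C (G (Suc i)) (G i)"
    and unb: "\<And>i. unbounded_index L \<kappa> C (G i) (G (Suc i))"
  shows False
proof -
  let ?T = "\<lambda>i. tdg_group C (G i)"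
  define n where "n = tdg_dim (G 0)"
  have dim: "tdg_dim (G i) = n" for i unfolding n_def by (rule chain_dim[of G, OF sub])
  obtain \<Delta> where \<Delta>: "exact_formulas (G 0) \<Delta>" using exact_formulas_exist[OF G] .
  define good where "good i \<Psi> \<alpha> \<longleftrightarrow> finite \<Psi> \<and> \<Psi> \<subseteq> tdg_type (G (Suc i)) \<and>
    (\<forall>j :: nat. \<alpha> j \<in> carrier (?T i)) \<and>
    (\<forall>j j'. j \<noteq> j' \<longrightarrow> \<not> cosets_meet (G i) \<Psi> (\<alpha> j) (\<alpha> j'))" for i \<Psi> \<alpha>
  have "\<exists>\<Psi> \<alpha>. good i \<Psi> \<alpha>" for i
  proof -
    obtain \<Psi> X where X: "finite \<Psi>" "\<Psi> \<subseteq> tdg_type (G (Suc i))" "infinite X" "X \<subseteq> carrier (?T i)"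
      "\<And>g h. g \<in> X \<Longrightarrow> h \<in> X \<Longrightarrow> g \<noteq> h \<Longrightarrow> \<not> cosets_meet (G i) \<Psi> g h"
      by (rule unbounded_index_separated[OF G[of i] G[of "Suc i"] sub[of i] unb[of i]]) (rule that)
    obtain \<alpha> :: "nat \<Rightarrow> 'm list" where \<alpha>: "inj \<alpha>" "range \<alpha> \<subseteq> X"
      using infinite_countable_subset[OF X(3)] by blast
    have "good i \<Psi> \<alpha>"
      unfolding good_def
    proof (intro conjI allI impI X(1,2))
      show "\<alpha> j \<in> carrier (?T i)" for j using \<alpha>(2) X(4) by blast
      show "\<not> cosets_meet (G i) \<Psi> (\<alpha> j) (\<alpha> j')" if "j \<noteq> j'" for j j'
        using \<alpha> that by (intro X(5)) (auto dest: injD)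
    qed
    then show ?thesis by blast
  qed
  then obtain \<Psi> \<alpha> where good: "\<And>i. good i (\<Psi> i) (\<alpha> i)" by metis
  have \<Psi>: "finite (\<Psi> i)" "\<Psi> i \<subseteq> tdg_type (G (Suc i))"
    and \<alpha>: "\<alpha> i j \<in> carrier (?T i)"
    and far: "j \<noteq> j' \<Longrightarrow> \<not> cosets_meet (G i) (\<Psi> i) (\<alpha> i j) (\<alpha> i j')" for i j j'
    using good[of i] unfolding good_def by blast+
  have \<alpha>_len: "length (\<alpha> i j) = n" "set (\<alpha> i j) \<subseteq> univ C" for i j
    using \<alpha>[of i j] by (auto simp: carrier_tdg realizations_def dim)

  \<comment> \<open>The blocks of variables are \<open>x\<close>, the factor of level \<open>i\<close>, and the factors of the levels
    below \<open>i\<close>.\<close>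
  define P where "P i e = quot_rel (G 0) \<Delta> (\<Psi> i) i (blk n 0 e)
    (\<lambda>k. blk n (if k = i then 1 else 2 + k) e)" for i e
  have "\<exists>q A. A \<subseteq> univ C \<and> q \<in> par_formulas L A ((2 + i) * n) \<and>
      (\<forall>as e. length as = (2 + i) * n \<longrightarrow> par_holds C q as = P i (as \<frown> e))" for i
  proof -
    let ?A = "tdg_params (G 0) \<union> tdg_params (G (Suc i))"
    have "definable ?A (P i)"
      unfolding P_def blk_def
    proof (rule definable_quot_rel)
      show "finite \<Delta>" "\<Delta> \<subseteq> par_formulas L ?A (tdg_dim (G 0))"
        using \<Delta> G[of 0] by (auto simp: exact_formulas_def type_definable_group_def par_formulas_def)
      show "finite (\<Psi> i)" "\<Psi> i \<subseteq> par_formulas L ?A (tdg_dim (G 0))"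
        using \<Psi>[of i] G[of "Suc i"] dim
        by (auto simp: type_definable_group_def par_formulas_def)
      show "tdg_op (G 0) \<in> par_formulas L ?A (3 * tdg_dim (G 0))"
        using G[of 0] by (auto simp: type_definable_group_def par_formulas_def)
    qed (auto simp: n_def)
    moreover have "P i e = P i e'" if e: "\<And>v. v < (2 + i) * n \<Longrightarrow> e v = e' v" for e e'
    proof -
      have "blk n k e = blk n k e'" if "k < 2 + i" for k
      proof -
        have "k * n + n \<le> (2 + i) * n" using mult_right_mono[of "Suc k" "2 + i" n] that by simp
        then show ?thesis unfolding blk_def by (intro map_cong refl e) auto
      qed
      then show ?thesis unfolding P_def
        using quot_rel_cong[of i "\<lambda>k. blk n (if k = i then 1 else 2 + k) e"
            "\<lambda>k. blk n (if k = i then 1 else 2 + k) e'"] by auto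
    qed
    ultimately obtain q where "q \<in> par_formulas L ?A ((2 + i) * n)"
      "\<And>as e. length as = (2 + i) * n \<Longrightarrow> par_holds C q as = P i (as \<frown> e)"
      using definable_par_formula[of ?A "P i" "(2 + i) * n"] by metis
    moreover have "?A \<subseteq> univ C" using G by (auto simp: type_definable_group_def)
    ultimately show ?thesis by blast
  qed
  then obtain q A where A: "\<And>i. A i \<subseteq> univ C" and q: "\<And>i. q i \<in> par_formulas L (A i) ((2 + i) * n)"
    "\<And>i as e. length as = (2 + i) * n \<Longrightarrow> par_holds C (q i) as = P i (as \<frown> e)" by metis
  define c where "c i = snd (q i)" for i
  \<comment> \<open>The parameters move from the end of the tuple to the place after the second block.\<close>
  define f where "f i v = (if v < 2 * n then v
    else if v < 2 * n + i * n then v + length (c i) else v - i * n)" for i v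
  define \<phi> where "\<phi> i = ren (f i) (fst (q i))" for i
  have fv_q: "fst (q i) \<in> formulas L" "fv (fst (q i)) \<subseteq> {..<2 * n + i * n + length (c i)}" for i
    using q(1)[of i] by (auto simp: par_formulas_def c_def algebra_simps)
  have holds_\<phi>: "holds C (\<phi> i) (x @ (ys i @ c i) @ concat (map ys [0..<i])) \<longleftrightarrow>
      quot_rel (G 0) \<Delta> (\<Psi> i) i x ys" if len: "length x = n" "\<And>k. length (ys k) = n" for i x ys
  proof -
    let ?z = "concat (map ys [0..<i])"
    let ?xs = "x @ ys i @ ?z"
    have len_z: "length ?z = i * n" using len by (induction i) auto
    define xy where "xy = x @ ys i"
    have len_xy: "length xy = 2 * n" using len by (simp add: xy_def)
    have "holds C (\<phi> i) (x @ (ys i @ c i) @ ?z) \<longleftrightarrow> par_holds C (q i) ?xs"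
      unfolding \<phi>_def holds_def par_holds_def sat_ren
    proof (rule sat_cong)
      fix v assume "v \<in> fv (fst (q i))"
      then have "v < 2 * n + i * n + length (c i)" using fv_q(2)[of i] by auto
      then have "(xy @ c i @ ?z) ! f i v = (xy @ ?z @ c i) ! v"
        unfolding f_def by (intro nth_append_swap len_xy len_z) auto
      then show "(x @ (ys i @ c i) @ ?z) ! f i v = (?xs @ snd (q i)) ! v"
        by (simp add: xy_def c_def)
    qed
    also have "\<dots> = P i (?xs \<frown> (\<lambda>_. undefined))"
      using len len_z by (intro q(2)) simp
    also have "\<dots> = quot_rel (G 0) \<Delta> (\<Psi> i) i x ys"
    proof -
      have blk: "blk n k (?xs \<frown> e) = ([x, ys i] @ map ys [0..<i]) ! k" if "k < 2 + i"
        for k and e :: "nat \<Rightarrow> 'm"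
        using blk_concat[of "[x, ys i] @ map ys [0..<i]" n k e] len that by auto
      then have 0: "blk n 0 (?xs \<frown> (\<lambda>_. undefined)) = x" by simp
      show ?thesis unfolding P_def 0
        by (rule quot_rel_cong) (use blk in \<open>auto simp: nth_append\<close>)
    qed
    finally show ?thesis .
  qed

  define N where "N i = n + length (c i)" for i
  define bv where "bv i = concat (map (\<lambda>k. take n (vars N k 0)) [0..<i])" for i
  have len_bv: "length (bv i) = i * n" for i
    by (induction i) (auto simp: bv_def N_def)
  have fv_\<phi>: "fv (\<phi> i) \<subseteq> {..<n + N i + i * n}" for i
  proof -
    have "f i v < n + N i + i * n" if "v < 2 * n + i * n + length (c i)" for v
      using that by (auto simp: f_def N_def)
    then show ?thesis using fv_ren[of "f i" "fst (q i)"] fv_q(2)[of i] unfolding \<phi>_def by blast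
  qed
  have \<phi>_form: "\<phi> i \<in> formulas L" for i unfolding \<phi>_def by (intro ren_formulas fv_q)
  define \<Theta> where "\<Theta> m e \<longleftrightarrow> (\<exists>x. length x = n \<and> set x \<subseteq> univ C \<and> (\<forall>i\<in>{..m}.
    holds C (\<phi> i) (x @ map e (vars N i 0) @ map e (bv i)) \<and>
    \<not> holds C (\<phi> i) (x @ map e (vars N i 1) @ map e (bv i))))" for m e
  have def_\<Theta>: "definable {} (\<Theta> m)" for m
  proof -
    have "definable {} (\<lambda>e. holds C (\<phi> i) (map e [0..<n] @ map (\<lambda>v. e (v + n)) (vars N i j) @
        map (\<lambda>v. e (v + n)) (bv i)))" for i j
      using definable_holds[OF \<phi>_form[of i],
          of "[0..<n] @ map (\<lambda>v. v + n) (vars N i j) @ map (\<lambda>v. v + n) (bv i)" "{}"]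
        fv_\<phi>[of i] len_bv[of i] by (simp add: o_def add.assoc)
    then show ?thesis unfolding \<Theta>_def[abs_def]
      by (intro definable_Ex_tuple definable_Ball definable_And definable_Not) auto
  qed
  have \<Theta>_chain: "\<Theta> m e"
    if g: "\<And>i. strict_mono (g i)" and e: "\<And>i j. map e (vars N i j) = \<alpha> i (g i j) @ c i"
    for g :: "nat \<Rightarrow> nat \<Rightarrow> nat" and e m
  proof -
    define y where "y k = \<alpha> k (g k 0)" for k
    define x where "x = tail_prod (?T 0) y (Suc m)"
    have y: "y k \<in> carrier (?T k)" for k unfolding y_def by (rule \<alpha>)
    have bv: "map e (bv i) = concat (map y [0..<i])" for i
      using \<alpha>_len by (simp add: bv_def map_concat o_def take_map[symmetric] e y_def[abs_def])
    have "x \<in> carrier (?T 0)"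
    proof -
      interpret group "?T 0" using G by (simp add: type_definable_group_def)
      show ?thesis unfolding x_def
        using y chain_antimono[of G, OF sub, of 0] by (intro tail_prod_closed) blast
    qed
    then have x: "length x = n" "set x \<subseteq> univ C" by (auto simp: carrier_tdg realizations_def dim)
    show ?thesis unfolding \<Theta>_def
    proof (intro exI[of _ x] conjI x ballI)
      fix i assume "i \<in> {..m}"
      then have i: "i \<le> m" by simp
      note quotients = chain_quotients[of G, OF G sub \<Delta> \<Psi>(2)[of i] y i x_def]
      have "holds C (\<phi> i) (x @ (y i @ c i) @ concat (map y [0..<i]))"
        using quotients(1) \<alpha>_len x by (subst holds_\<phi>) (auto simp: y_def)
      then show "holds C (\<phi> i) (x @ map e (vars N i 0) @ map e (bv i))"
        unfolding bv e by (simp add: y_def)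
      define h where "h = \<alpha> i (g i 1)"
      have "g i 1 \<noteq> g i 0" using strict_monoD[OF g[of i], of 0 1] by simp
      then have "\<not> quot_rel (G 0) \<Delta> (\<Psi> i) i x (y(i := h))"
        using far \<alpha> by (intro quotients(2)) (auto simp: h_def y_def)
      then have "\<not> holds C (\<phi> i) (x @ ((y(i := h)) i @ c i) @ concat (map (y(i := h)) [0..<i]))"
        using \<alpha>_len x by (subst holds_\<phi>) (auto simp: y_def h_def)
      moreover have "map (y(i := h)) [0..<i] = map y [0..<i]" by simp
      ultimately show "\<not> holds C (\<phi> i) (x @ map e (vars N i 1) @ map e (bv i))"
        unfolding bv e by (simp add: h_def)
    qed
  qed
  have c_univ: "set (c i) \<subseteq> univ C" for i
    using q(1)[of i] A[of i] by (auto simp: par_formulas_def c_def)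
  obtain e where e: "range e \<subseteq> univ C" "indiscernible_array L C {} (\<lambda>i j. map e (vars N i j))"
    "\<And>P. P \<in> range \<Theta> \<Longrightarrow> P e"
  proof (rule extract_indiscernible_array[of "\<lambda>i j. \<alpha> i j @ c i" N "range \<Theta>"])
    show "length (\<alpha> i j @ c i) = N i \<and> set (\<alpha> i j @ c i) \<subseteq> univ C" for i j
      using \<alpha>_len c_univ by (simp add: N_def)
    show "definable {} P" if "P \<in> range \<Theta>" for P using that def_\<Theta> by blast
    show "P e" if "\<And>i. strict_mono (g i)" "\<And>i j. map e (vars N i j) = \<alpha> i (g i j) @ c i" "P \<in> range \<Theta>"
      for g e P using that \<Theta>_chain by blast
  qed (rule that)
  let ?a = "\<lambda>i j. map e (vars N i j)" and ?b = "\<lambda>i. map e (bv i)"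
  let ?p = "\<Union>i. {(\<phi> i, ?a i 0 @ ?b i), (Neg (\<phi> i), ?a i 1 @ ?b i)}"
  have "consistent C n ?p"
    unfolding consistent_def
  proof (intro allI impI)
    fix r assume r: "finite r \<and> r \<subseteq> ?p"
    then obtain I where I: "finite I" "r \<subseteq> (\<Union>i\<in>I. {(\<phi> i, ?a i 0 @ ?b i), (Neg (\<phi> i), ?a i 1 @ ?b i)})"
      using finite_subset_Union[of r "range (\<lambda>i. {(\<phi> i, ?a i 0 @ ?b i), (Neg (\<phi> i), ?a i 1 @ ?b i)})"]
        finite_subset_image by (metis (no_types, lifting))
    obtain m where m: "I \<subseteq> {..m}" using I(1) finite_nat_iff_bounded_le by blast
    have "\<Theta> m e" using e(3) by blast
    then obtain x where x: "length x = n" "set x \<subseteq> univ C" "\<And>i. i \<le> m \<Longrightarrow>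
      holds C (\<phi> i) (x @ ?a i 0 @ ?b i) \<and> \<not> holds C (\<phi> i) (x @ ?a i 1 @ ?b i)"
      unfolding \<Theta>_def by auto
    have "x \<in> realizations C n r"
      unfolding realizations_def
    proof (intro CollectI conjI ballI x(1,2))
      fix s assume "s \<in> r"
      then obtain i where "i \<le> m" "s = (\<phi> i, ?a i 0 @ ?b i) \<or> s = (Neg (\<phi> i), ?a i 1 @ ?b i)"
        using I(2) m by auto
      then show "par_holds C s x" using x(3)[of i] by (auto simp: par_holds_def holds_def)
    qed
    then show "realizations C n r \<noteq> {}" by blast
  qed
  moreover have "\<phi> i \<in> formulas L \<and> fv (\<phi> i) \<subseteq> {..<n + length (?a i 0) + length (?b i)}" for i
    using \<phi>_form fv_\<phi> len_bv by simp
  moreover have "set (?b k) \<subseteq> (\<Union>i\<in>{..<k}. \<Union>j. set (?a i j))" for k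
    by (force simp: bv_def dest: in_set_takeD)
  ultimately have "\<exists>n \<phi> a b. (\<forall>i. \<phi> i \<in> formulas L \<and>
      fv (\<phi> i) \<subseteq> {..<n + length (a i 0) + length (b i)}) \<and> indiscernible_array L C {} a \<and>
      (\<forall>k. set (b k) \<subseteq> (\<Union>i\<in>{..<k}. \<Union>j. set (a i j))) \<and>
      consistent C n (\<Union>i. {(\<phi> i, a i 0 @ b i), (Neg (\<phi> i), a i 1 @ b i)})"
    using e(2) by (intro exI[of _ n] exI[of _ \<phi>] exI[of _ ?a] exI[of _ ?b] conjI allI) auto
  then show False using s2 unfolding strongly2_dependent_def by blast
qed

end

theorem proposition2p4:
  fixes L :: "('f, 'r) lang"
    and T :: "('f, 'r) fm set"
    and \<kappa> :: "'k rel"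
    and C :: "('f, 'r, 'm) struct"
  assumes "complete_theory L T"
    and "monster_model L T \<kappa> C"
    and "strongly2_dependent L C"
  shows "\<not> (\<exists>G :: nat \<Rightarrow> ('f, 'r, 'm) tdgroup. \<forall>i.
            type_definable_group L \<kappa> C (G i) \<and>
            tdg_subgroup C (G (Suc i)) (G i) \<and>
            unbounded_index L \<kappa> C (G i) (G (Suc i)))"
proof -
  interpret saturated_structure L \<kappa> C
    using assms(2) by unfold_locales (simp_all add: monster_model_def is_model_def)
  show ?thesis using no_unbounded_chain[OF assms(3)] by blast
qed

end
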